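(* Let $\mathbb{T}$ be a time scale and let $a,b\in\mathbb{T}$ with $b>a$. Assume that $K,K^{\Delta_1}\in C_{rd}(\Omega(a,b),\mathbb{R})$, $f\in C_{rd}^{1}([a,b]_{\mathbb{T}},\mathbb{R})$ and that $K(\sigma(t),t)\neq0$ for all $t\in[a,b]_{\mathbb{T}^{\kappa}}$. Then the generalized Volterra integral equation of the first kind $$\int_a^t K(t,\eta)\varphi(\eta)\,\Delta\eta=f(t)\quad\text{for } t\in[a,b]_{\mathbb{T}}$$ admits a unique solution $\varphi$ on $[a,b]_{\mathbb{T}^{\kappa}}$.
   Context: A time scale $\mathbb{T}$ is a nonempty closed subset of $\mathbb{R}$ with the topology inherited from $\mathbb{R}$. A set written as a subscript on an interval denotes the intersection of the usual interval with that set, so $[a,b]_{\mathbb{T}}=[a,b]\cap\mathbb{T}$ and $[a,b]_{\mathbb{T}^{\kappa}}=[a,b]\cap\mathbb{T}^{\kappa}$. The forward and backward jump operators $\sigma,\rho:\mathbb{T}\to\mathbb{T}$ are $\sigma(t):=\inf(t,\infty)_{\mathbb{T}}$ and $\rho(t):=\sup(-\infty,t)_{\mathbb{T}}$ (with the usual conventions $\inf\emptyset=\sup\mathbb{T}$, $\sup\emptyset=\inf\mathbb{T}$). A point $t$ is right-dense if $\sigma(t)=t$ and left-dense if $\rho(t)=t$. The set $\mathbb{T}^{\kappa}$ is $\mathbb{T}\setminus\{\sup\mathbb{T}\}$ if $\sup\mathbb{T}=\max\mathbb{T}$ and $\rho(\max\mathbb{T})\neq\max\mathbb{T}$, and $\mathbb{T}^{\kappa}:=\mathbb{T}$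 otherwise. A function is rd-continuous if it is continuous at right-dense points and has finite limits at left-dense points; $C_{rd}$ denotes the set of rd-continuous functions on the indicated domain. The $\Delta$-derivative $g^{\Delta}(t)$ is the number $\ell$ such that for every $\varepsilon>0$ there is a neighborhood $U$ of $t$ with $|[g(\sigma(t))-g(s)]-\ell[\sigma(t)-s]|\le\varepsilon|\sigma(t)-s|$ for all $s\in U$; $C_{rd}^{1}$ is the set of functions whose $\Delta$-derivative is rd-continuous. The $\Delta$-integral is $\int_s^t g(\eta)\,\Delta\eta=G(t)-G(s)$, where $G$ is an antiderivative of $g$, i.e. $G^{\Delta}=g$. The set $\Omega(a,b)$ is $\{(t,s)\in\mathbb{T}\times\mathbb{T}:\ b\ge t\ge s\ge a\}$, and $H\in C_{rd}(\Omega(a,b),\mathbb{R})$ means that $H(\cdot,s)\in C_{rd}([s,b]_{\mathbb{T}},\mathbb{R})$ for each fixed $s\in[a,b]_{\mathbb{T}}$ and $H(t,\cdot)\in C_{rd}([a,t]_{\mathbb{T}},\mathbb{R})$ for each fixed $t\in[a,b]_{\mathbb{T}}$. $K^{\Delta_1}$ denotes the partial $\Delta$-derivative of $K$ with respect to its first variable.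
   Formalization: Added, as the claim fails without them: f(a)=0; K^{Δ1} bounded on Ω(a,b); 1/K(σ(t),t) bounded. Also [a,b]_T itself is taken as the time scale: σ and κ are its own, so b is excluded if left-scattered; solutions are rd-continuous. *)

theory Defs
  imports "HOL-Analysis.Analysis"
begin

definition time_scale :: "real set \<Rightarrow> bool" where
  "time_scale T \<longleftrightarrow> T \<noteq> {} \<and> closed T"

definition sigma :: "real set \<Rightarrow> real \<Rightarrow> real" where
  "sigma T t = (if T \<inter> {t<..} = {} then Sup T else Inf (T \<inter> {t<..}))"

definition rho :: "real set \<Rightarrow> real \<Rightarrow> real" where
  "rho T t = (if T \<inter> {..<t} = {} then Inf T else Sup (T \<inter> {..<t}))"

definition kappa :: "real set \<Rightarrow> real set" where
  "kappa T = {t \<in> T. \<not> ((\<forall>s\<in>T. s \<le> t) \<and> rho T t \<noteq> t)}"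

(* In the next two definitions S is the domain of g inside the time scale T: limits and
   neighbourhoods are taken in S, whereas sigma and rho, and hence density of points, refer
   to T. By the conventions for Sup and Inf of the empty set, max T is right-dense and min T
   is left-dense. *)

definition rd_continuous_on :: "real set \<Rightarrow> real set \<Rightarrow> (real \<Rightarrow> real) \<Rightarrow> bool" where
  "rd_continuous_on T S g \<longleftrightarrow>
     (\<forall>t\<in>S. sigma T t = t \<longrightarrow> continuous (at t within S) g) \<and>
     (\<forall>t\<in>S. rho T t = t \<longrightarrow> (\<exists>l. (g \<longlongrightarrow> l) (at t within S \<inter> {..<t})))"

definition has_delta_derivative ::
    "real set \<Rightarrow> real set \<Rightarrow> (real \<Rightarrow> real) \<Rightarrow> real \<Rightarrow> real \<Rightarrow> bool" where
  "has_delta_derivative T S g l t \<longleftrightarrow>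
     (\<forall>\<epsilon>>0. \<exists>U. open U \<and> t \<in> U \<and>
        (\<forall>s \<in> U \<inter> S. \<bar>(g (sigma T t) - g s) - l * (sigma T t - s)\<bar> \<le> \<epsilon> * \<bar>sigma T t - s\<bar>))"

definition rd_C1 :: "real set \<Rightarrow> (real \<Rightarrow> real) \<Rightarrow> bool" where
  "rd_C1 T g \<longleftrightarrow>
     (\<exists>g'. (\<forall>t \<in> kappa T. has_delta_derivative T T g (g' t) t) \<and>
           rd_continuous_on T (kappa T) g')"

(* The integral from s to t, for s \<le> t. The integrand need only be given up to t, so the
   antiderivative lives on T between s and sigma T t. *)
definition has_delta_integral ::
    "real set \<Rightarrow> (real \<Rightarrow> real) \<Rightarrow> real \<Rightarrow> real \<Rightarrow> real \<Rightarrow> bool" where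
  "has_delta_integral T g s t I \<longleftrightarrow>
     (\<exists>G. (\<forall>\<eta> \<in> kappa T \<inter> {s..t}.
             has_delta_derivative T (T \<inter> {s..sigma T t}) G (g \<eta>) \<eta>) \<and>
          I = G t - G s)"

definition Omega :: "real set \<Rightarrow> real \<Rightarrow> real \<Rightarrow> (real \<times> real) set" where
  "Omega T a b = {(t, s) \<in> T \<times> T. a \<le> s \<and> s \<le> t \<and> t \<le> b}"

definition rd_continuous_Omega ::
    "real set \<Rightarrow> real \<Rightarrow> real \<Rightarrow> (real \<Rightarrow> real \<Rightarrow> real) \<Rightarrow> bool" where
  "rd_continuous_Omega T a b H \<longleftrightarrow>
     (\<forall>s \<in> T \<inter> {a..b}. rd_continuous_on T (T \<inter> {s..b}) (\<lambda>t. H t s)) \<and>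
     (\<forall>t \<in> T \<inter> {a..b}. rd_continuous_on T (T \<inter> {a..t}) (\<lambda>s. H t s))"

(* H is the partial delta derivative of K in the first variable. The section of K at s is a
   function on T between s and b, so at t = s the derivative is one-sided. *)
definition delta1_derivative ::
    "real set \<Rightarrow> real \<Rightarrow> real \<Rightarrow> (real \<Rightarrow> real \<Rightarrow> real) \<Rightarrow> (real \<Rightarrow> real \<Rightarrow> real) \<Rightarrow> bool" where
  "delta1_derivative T a b K H \<longleftrightarrow>
     (\<forall>s \<in> T \<inter> {a..b}. \<forall>t \<in> kappa T \<inter> {s..b}.
        has_delta_derivative T (T \<inter> {s..b}) (\<lambda>\<tau>. K \<tau> s) (H t s) t)"

definition volterra1_solution ::
    "real set \<Rightarrow> real \<Rightarrow> real \<Rightarrow> (real \<Rightarrow> real \<Rightarrow> real) \<Rightarrow> (real \<Rightarrow> real) \<Rightarrow> (real \<Rightarrow> real) \<Rightarrow> bool" where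
  "volterra1_solution T a b K f \<phi> \<longleftrightarrow>
     rd_continuous_on T (kappa T \<inter> {a..b}) \<phi> \<and>
     (\<forall>t \<in> T \<inter> {a..b}. has_delta_integral T (\<lambda>\<eta>. K t \<eta> * \<phi> \<eta>) a t (f t))"

(* Passing from T to the time scale of its points between a and b changes neither sigma
   before b nor, when b is the maximum of T, the set kappa. *)

lemma sigma_Int_Icc:
  assumes "b \<in> T" "a \<le> t" "t < b"
  shows "sigma (T \<inter> {a..b}) t = sigma T t"
proof -
  let ?A = "T \<inter> {t<..}" and ?B = "T \<inter> {a..b} \<inter> {t<..}"
  have b: "b \<in> ?B" using assms by auto
  have bdd: "bdd_below ?A" "bdd_below ?B" by (auto intro!: bdd_belowI[of _ t])
  have "Inf ?A = Inf ?B"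
  proof (rule antisym)
    show "Inf ?A \<le> Inf ?B"
      using b bdd by (intro cInf_superset_mono) auto
    show "Inf ?B \<le> Inf ?A"
    proof (rule cInf_greatest)
      show "?A \<noteq> {}" using b by auto
      fix x assume x: "x \<in> ?A"
      show "Inf ?B \<le> x"
      proof (cases "x \<le> b")
        case True
        then show ?thesis using x assms bdd by (intro cInf_lower) auto
      next
        case False
        have "Inf ?B \<le> b" using b bdd by (intro cInf_lower) auto
        then show ?thesis using False by simp
      qed
    qed
  qed
  then show ?thesis using b by (auto simp: sigma_def)
qed

lemma kappa_Int_Icc:
  assumes "a \<in> T" "b \<in> T" "a < b" "\<forall>s\<in>T. s \<le> b"
  shows "kappa (T \<inter> {a..b}) = kappa T \<inter> {a..b}"
proof -
  let ?A = "T \<inter> {..<b}" and ?B = "T \<inter> {a..b} \<inter> {..<b}"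
  have a: "a \<in> ?B" using assms by auto
  have bdd: "bdd_above ?A" "bdd_above ?B" by (auto intro!: bdd_aboveI[of _ b])
  have "Sup ?A = Sup ?B"
  proof (rule antisym)
    show "Sup ?B \<le> Sup ?A"
      using a bdd by (intro cSup_subset_mono) auto
    show "Sup ?A \<le> Sup ?B"
    proof (rule cSup_least)
      show "?A \<noteq> {}" using a by auto
      fix x assume x: "x \<in> ?A"
      show "x \<le> Sup ?B"
      proof (cases "a \<le> x")
        case True
        then show ?thesis using x bdd by (intro cSup_upper) auto
      next
        case False
        have "a \<le> Sup ?B" using a bdd by (intro cSup_upper) auto
        then show ?thesis using False by simp
      qed
    qed
  qed
  then have r: "rho (T \<inter> {a..b}) b = rho T b" using a by (auto simp: rho_def)
  have m: "(\<forall>s\<in>T \<inter> {a..b}. s \<le> t) \<longleftrightarrow> t = b" "(\<forall>s\<in>T. s \<le> t) \<longleftrightarrow> t = b"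
    if "t \<in> T \<inter> {a..b}" for t
    using that assms by force+
  show ?thesis
  proof (rule set_eqI)
    fix t
    show "t \<in> kappa (T \<inter> {a..b}) \<longleftrightarrow> t \<in> kappa T \<inter> {a..b}"
    proof (cases "t \<in> T \<inter> {a..b}")
      case True
      then show ?thesis using True m[OF True] r by (cases "t = b") (simp_all add: kappa_def)
    next
      case False
      then show ?thesis by (auto simp: kappa_def)
    qed
  qed
qed

end

theory Submission
  imports Defs
begin

text \<open>
  Differentiating the equation turns it into an equation of the second kind. If \<phi> solves it, then
  the Leibniz rule for integrals with a variable upper limit gives, on \<open>kappa J\<close>,
  \<open>K (\<sigma> t) t * \<phi> t + (integral from a to t of K1 t \<eta> * \<phi> \<eta>) = f\<^sup>\<Delta> t\<close>,
  and since both sides of the original equation vanish at \<open>a\<close>, nothing is lost: two functions with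
  equal \<Delta>-derivatives and equal initial values agree (\<open>mean_value_bound\<close>, \<open>second_kind_iff\<close>).
  Dividing by the diagonal \<open>K (\<sigma> t) t\<close>, whose reciprocal is bounded, leaves a fixed point problem for
  a Volterra operator with bounded kernel. In the norm weighted by an exponential of large rate this
  operator halves distances (\<open>second_kind_op_bound\<close>), so iteration from \<open>0\<close> converges and the fixed
  point is unique.

  The difficulty is that \<open>K\<close> and \<open>K1\<close> are rd-continuous only in each variable separately, which
  gives no continuity of \<open>K\<close> as a function of two variables. Two devices replace it.
  First, the \<Delta>-integral is written as a Lebesgue integral: every real \<open>x\<close> is sent to the last point of \<open>J\<close> that is not beyond \<open>x\<close>, and an
  integrand composed with this map is right-continuous, hence measurable, when it is rd-continuous.
  Pointwise limits in the first variable then pass under the integral by dominated convergence.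
  Secondly, the bound on \<open>K1\<close> makes \<open>K\<close> Lipschitz in its first variable, uniformly in the second. This
  is enough to make the diagonal rd-continuous (\<open>diag_rd\<close>), and it lets \<open>K t \<eta>\<close> be split into
  \<open>K (\<sigma> \<eta>) \<eta>\<close>, to which the fundamental theorem applies, and a remainder that is small near
  \<open>\<eta> = t\<close> (\<open>remainder_op_derivative\<close>).
\<close>

section \<open>Measurability and dominated convergence on the line\<close>

text \<open>Sampling \<open>h\<close> at the next point of the grid of mesh \<open>1 / (n + 1)\<close> strictly to the right gives a
  function of an integer-valued floor; these functions converge to \<open>h\<close> because the samples approach
  from the right.\<close>
lemma right_continuous_imp_borel_measurable:
  fixes h :: "real \<Rightarrow> real"
  assumes "\<And>x. (h \<longlongrightarrow> h x) (at_right x)"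
  shows "h \<in> borel_measurable borel"
proof (rule borel_measurable_LIMSEQ_real)
  define q where "q n x = (real_of_int \<lfloor>real (Suc n) * x\<rfloor> + 1) / real (Suc n)" for n x
  show "(\<lambda>n. h (q n x)) \<longlonglongrightarrow> h x" for x
  proof -
    have gt: "q n x > x" and le: "q n x \<le> x + 1 / real (Suc n)" for n
    proof -
      have "real (Suc n) * x < real_of_int \<lfloor>real (Suc n) * x\<rfloor> + 1" by linarith
      then show "q n x > x" unfolding q_def by (simp add: field_simps)
      have "real_of_int \<lfloor>real (Suc n) * x\<rfloor> + 1 \<le> real (Suc n) * x + 1" by linarith
      then have "q n x \<le> (real (Suc n) * x + 1) / real (Suc n)"
        unfolding q_def by (rule divide_right_mono) simp
      then show "q n x \<le> x + 1 / real (Suc n)" by (simp add: add_divide_distrib)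
    qed
    have "(\<lambda>n. x + 1 / real (Suc n)) \<longlonglongrightarrow> x"
      using LIMSEQ_inverse_real_of_nat_add[of x] by (simp add: inverse_eq_divide)
    then have "(\<lambda>n. q n x) \<longlonglongrightarrow> x"
    proof (rule real_tendsto_sandwich[OF _ _ tendsto_const, rotated 2])
      show "\<forall>\<^sub>F n in sequentially. x \<le> q n x" by (rule always_eventually) (use gt less_imp_le in blast)
      show "\<forall>\<^sub>F n in sequentially. q n x \<le> x + 1 / real (Suc n)" by (rule always_eventually) (use le in blast)
    qed
    then have "filterlim (\<lambda>n. q n x) (at_right x) sequentially"
      using gt by (auto simp: filterlim_at intro!: always_eventually) (metis less_irrefl)
    then show ?thesis by (rule filterlim_compose[OF assms])
  qed
  show "(\<lambda>x. h (q n x)) \<in> borel_measurable borel" for n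
  proof -
    have "(\<lambda>x. \<lfloor>real (Suc n) * x\<rfloor>) \<in> measurable borel (count_space UNIV)"
      by measurable
    from measurable_compose[OF this, of "\<lambda>i. h ((real_of_int i + 1) / real (Suc n))" borel]
    have "(\<lambda>x. h ((real_of_int \<lfloor>real (Suc n) * x\<rfloor> + 1) / real (Suc n))) \<in> borel_measurable borel"
      by simp
    then show ?thesis by (simp add: q_def)
  qed
qed

text \<open>Dominated convergence when the upper limit of integration moves as well. Both the Volterra
  integrals at a sequence of times and their difference quotients are of this form. The limit point
  \<open>t\<close> itself is exceptional, because \<open>x i\<close> may approach it from either side, but it is a null set; the
  measurability claim is what later makes limits of integrands integrable.\<close>
lemma bounded_convergence_moving_end:
  fixes u :: "nat \<Rightarrow> real \<Rightarrow> real" and v :: "real \<Rightarrow> real"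
  assumes meas: "\<And>i. (\<lambda>y. indicator {a..<x i} y * u i y) \<in> borel_measurable borel"
    and bound: "\<And>i y. a \<le> y \<Longrightarrow> y < x i \<Longrightarrow> \<bar>u i y\<bar> \<le> C"
    and x: "\<And>i. x i \<le> b" "x \<longlonglongrightarrow> t"
    and lim: "\<And>y. a \<le> y \<Longrightarrow> y < t \<Longrightarrow> (\<lambda>i. u i y) \<longlonglongrightarrow> v y"
  shows "(\<lambda>y. indicator {a..<t} y * v y) \<in> borel_measurable borel"
    and "(\<lambda>i. LINT y|lborel. indicator {a..<x i} y * u i y) \<longlonglongrightarrow>
         (LINT y|lborel. indicator {a..<t} y * v y)"
proof -
  have pw: "(\<lambda>i. indicator {a..<x i} y * u i y) \<longlonglongrightarrow> indicator {a..<t} y * v y" if "y \<noteq> t" for y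
  proof (cases "y < t")
    case True
    have ev: "\<forall>\<^sub>F i in sequentially. y < x i" using order_tendstoD(1)[OF x(2) True] .
    show ?thesis
    proof (cases "a \<le> y")
      case ay: True
      have "\<forall>\<^sub>F i in sequentially. indicator {a..<x i} y * u i y = u i y"
        using ev by eventually_elim (use ay in simp)
      from tendsto_cong[OF this] show ?thesis using lim[OF ay True] True ay by simp
    qed simp
  next
    case False
    then have "t < y" using that by simp
    then have "\<forall>\<^sub>F i in sequentially. x i < y" using order_tendstoD(2)[OF x(2)] by simp
    then have "\<forall>\<^sub>F i in sequentially. indicator {a..<x i} y * u i y = 0"
      by eventually_elim simp
    then show ?thesis using \<open>t < y\<close> by (simp add: tendsto_eventually)
  qed
  \<comment> \<open>convergence may fail at \<open>t\<close>, so the sequence is cut off below \<open>t\<close> to have a limit everywhere\<close>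
  have "(\<lambda>y. indicator {..<t} y * (indicator {a..<t} y * v y)) \<in> borel_measurable borel"
  proof (rule borel_measurable_LIMSEQ_real)
    show "(\<lambda>y. indicator {..<t} y * (indicator {a..<x i} y * u i y)) \<in> borel_measurable borel" for i
      using meas[of i] by measurable
    show "(\<lambda>i. indicator {..<t} y * (indicator {a..<x i} y * u i y))
        \<longlonglongrightarrow> indicator {..<t} y * (indicator {a..<t} y * v y)" for y
      using pw[of y] by (cases "y < t") auto
  qed
  also have "(\<lambda>y. indicator {..<t} y * (indicator {a..<t} y * v y)) = (\<lambda>y. indicator {a..<t} y * v y)"
    by (auto simp: indicator_def)
  finally show m: "(\<lambda>y. indicator {a..<t} y * v y) \<in> borel_measurable borel" .
  show "(\<lambda>i. LINT y|lborel. indicator {a..<x i} y * u i y) \<longlonglongrightarrow>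
         (LINT y|lborel. indicator {a..<t} y * v y)"
  proof (rule integral_dominated_convergence[where w = "\<lambda>y. indicator {a..<b} y * \<bar>C\<bar>"])
    show "AE y in lborel. (\<lambda>i. indicator {a..<x i} y * u i y) \<longlonglongrightarrow> indicator {a..<t} y * v y"
      using AE_lborel_singleton[of t] by eventually_elim (rule pw)
    show "AE y in lborel. norm (indicator {a..<x i} y * u i y) \<le> indicator {a..<b} y * \<bar>C\<bar>" for i
    proof (rule AE_I2)
      fix y
      show "norm (indicator {a..<x i} y * u i y) \<le> indicator {a..<b} y * \<bar>C\<bar>"
        using bound[of y i] x(1)[of i] by (auto simp: indicator_def)
    qed
    show "integrable lborel (\<lambda>y. indicator {a..<b} y * \<bar>C\<bar>)"
      by (cases "a \<le> b") auto
  qed (use meas m in auto)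
qed

section \<open>Compact time scales\<close>

locale compact_time_scale =
  fixes J :: "real set" and a b :: real
  assumes closed_J: "closed J" and J_subset: "J \<subseteq> {a..b}"
    and a_in: "a \<in> J" and b_in: "b \<in> J" and a_less_b: "a < b"
begin

lemma J_bounds: "t \<in> J \<Longrightarrow> a \<le> t" "t \<in> J \<Longrightarrow> t \<le> b"
  using J_subset by auto

lemma bdd_J: "A \<subseteq> J \<Longrightarrow> bdd_below A" "A \<subseteq> J \<Longrightarrow> bdd_above A"
  by (meson J_subset bdd_below_Icc bdd_below_mono subset_trans)
    (meson J_subset bdd_above_Icc bdd_above_mono subset_trans)

lemma Inf_in_J: "A \<subseteq> J \<Longrightarrow> A \<noteq> {} \<Longrightarrow> Inf A \<in> J"
  using closure_contains_Inf[of A] closure_minimal[of A J] closed_J bdd_J(1)[of A] by (metis subsetD)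

lemma Sup_in_J: "A \<subseteq> J \<Longrightarrow> A \<noteq> {} \<Longrightarrow> Sup A \<in> J"
  using closure_contains_Sup[of A] closure_minimal[of A J] closed_J bdd_J(2)[of A] by (metis subsetD)

lemma sigma_max [simp]: "sigma J b = b"
proof -
  have "J \<inter> {b<..} = {}" using J_bounds(2) by force
  moreover have "Sup J = b" using b_in J_bounds(2) by (intro cSup_eq_maximum)
  ultimately show ?thesis by (simp add: sigma_def)
qed

lemma rho_min: "rho J a = a"
proof -
  have "J \<inter> {..<a} = {}" using J_bounds(1) by force
  moreover have "Inf J = a" using a_in J_bounds(1) by (intro cInf_eq_minimum)
  ultimately show ?thesis by (simp add: rho_def)
qed

lemma sigma_le: "z \<in> J \<Longrightarrow> t < z \<Longrightarrow> sigma J t \<le> z"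
  using bdd_J(1)[of "J \<inter> {t<..}"] by (auto simp: sigma_def intro: cInf_lower)

lemma sigma_in: assumes "t \<in> J" shows "sigma J t \<in> J"
proof -
  have "Sup J \<in> J" using Sup_in_J[of J] assms by auto
  then show ?thesis using Inf_in_J[of "J \<inter> {t<..}"] by (auto simp: sigma_def)
qed

lemma sigma_ge: assumes "t \<in> J" shows "t \<le> sigma J t"
proof (cases "t = b")
  case False
  then have "b \<in> J \<inter> {t<..}" using J_bounds[OF assms] b_in by auto
  then show ?thesis by (auto simp: sigma_def intro!: cInf_greatest)
qed simp

lemma sigma_bounds: "t \<in> J \<Longrightarrow> a \<le> sigma J t" "t \<in> J \<Longrightarrow> sigma J t \<le> b"
  using sigma_in J_bounds by auto

lemma right_dense_points:
  assumes "t \<in> J" "t < b" "sigma J t = t" "e > 0"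
  obtains z where "z \<in> J" "t < z" "z < t + e"
proof -
  have ne: "J \<inter> {t<..} \<noteq> {}" using assms b_in by auto
  then have "Inf (J \<inter> {t<..}) < t + e" using assms by (auto simp: sigma_def)
  then show ?thesis using cInf_less_iff[OF ne bdd_J(1)] that by auto
qed

lemma left_dense_points:
  assumes "t \<in> J" "a < t" "rho J t = t" "e > 0"
  obtains z where "z \<in> J" "t - e < z" "z < t"
proof -
  have ne: "J \<inter> {..<t} \<noteq> {}" using assms a_in by auto
  then have "t - e < Sup (J \<inter> {..<t})" using assms by (auto simp: rho_def)
  then show ?thesis using less_cSup_iff[OF ne bdd_J(2)] that by auto
qed

lemma left_scattered:
  assumes "t \<in> J" "rho J t \<noteq> t"
  shows "rho J t \<in> J" "rho J t < t" "\<And>z. z \<in> J \<Longrightarrow> z < t \<Longrightarrow> z \<le> rho J t"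
proof -
  have "t \<noteq> a" using assms rho_min by auto
  then have ne: "J \<inter> {..<t} \<noteq> {}" using J_bounds[OF assms(1)] a_in by auto
  then have eq: "rho J t = Sup (J \<inter> {..<t})" by (simp add: rho_def)
  show "rho J t \<in> J" using Sup_in_J[of "J \<inter> {..<t}"] ne eq by auto
  have "Sup (J \<inter> {..<t}) \<le> t" using ne by (intro cSup_least) auto
  then show "rho J t < t" using assms eq by auto
  show "z \<le> rho J t" if "z \<in> J" "z < t" for z
    unfolding eq using that bdd_J(2) by (intro cSup_upper) auto
qed

lemma kappa_subset: "kappa J \<subseteq> J"
  by (auto simp: kappa_def)

lemma in_kappa: "t \<in> J \<Longrightarrow> t < b \<Longrightarrow> t \<in> kappa J"
  using b_in by (force simp: kappa_def)

lemma kappa_max: "b \<in> kappa J \<longleftrightarrow> rho J b = b"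
  using b_in J_bounds(2) by (auto simp: kappa_def)

lemma closed_kappa: "closed (kappa J)"
proof (cases "rho J b = b")
  case True
  then have "kappa J = J" using kappa_subset in_kappa kappa_max J_bounds(2) by fastforce
  then show ?thesis using closed_J by simp
next
  case False
  have "kappa J = J \<inter> {..rho J b}"
  proof
    show "kappa J \<subseteq> J \<inter> {..rho J b}"
    proof
      fix t assume t: "t \<in> kappa J"
      then have "t \<in> J" "t \<noteq> b" using kappa_subset False kappa_max by auto
      then show "t \<in> J \<inter> {..rho J b}" using left_scattered(3)[OF b_in False] J_bounds(2)[of t] by auto
    qed
    show "J \<inter> {..rho J b} \<subseteq> kappa J"
      using left_scattered(2)[OF b_in False] in_kappa by auto
  qed
  then show ?thesis using closed_J by (simp add: closed_Int)
qed

text \<open>The retraction of \<open>[a, b]\<close> onto \<open>J\<close> that collapses each gap to its left end point.\<close>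
definition left_end :: "real \<Rightarrow> real" where
  "left_end x = Sup (J \<inter> {..x})"

lemma
  assumes "a \<le> x"
  shows left_end_in: "left_end x \<in> J" and left_end_le: "left_end x \<le> x" and left_end_greatest: "\<And>z. z \<in> J \<Longrightarrow> z \<le> x \<Longrightarrow> z \<le> left_end x"
proof -
  have ne: "J \<inter> {..x} \<noteq> {}" using assms a_in by auto
  show "left_end x \<in> J" using Sup_in_J[of "J \<inter> {..x}"] ne by (auto simp: left_end_def)
  show "left_end x \<le> x" unfolding left_end_def using ne by (intro cSup_least) auto
  show "z \<le> left_end x" if "z \<in> J" "z \<le> x" for z
    unfolding left_end_def using that bdd_J(2) by (intro cSup_upper) auto
qed

text \<open>Every point below \<open>b\<close> is either followed by an interval on which the retraction is constant or is
  a right-dense point of \<open>J\<close>. These are the two ways in which a function composed with the retraction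
  can be right-continuous.\<close>
lemma less_sigma_left_end:
  assumes "a \<le> x" "x < b" shows "x < sigma J (left_end x) \<or> sigma J (left_end x) = left_end x \<and> left_end x = x"
proof (rule ccontr)
  assume *: "\<not> ?thesis"
  have "sigma J (left_end x) \<le> left_end x"
    using * left_end_greatest[OF assms(1) sigma_in[OF left_end_in[OF assms(1)]]] by auto
  then have eq: "sigma J (left_end x) = left_end x" using sigma_ge[OF left_end_in[OF assms(1)]] by simp
  then have "left_end x < x" using * left_end_le[OF assms(1)] by auto
  then obtain z where "z \<in> J" "left_end x < z" "z < left_end x + (x - left_end x)"
    using right_dense_points[of "left_end x" "x - left_end x"] left_end_in[OF assms(1)] eq assms by auto
  then show False using left_end_greatest[OF assms(1), of z] by auto
qed

lemma left_end_eqI: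
  assumes "t \<in> J" "t \<le> x" "x < sigma J t" shows "left_end x = t"
proof (rule antisym)
  have ax: "a \<le> x" using assms J_bounds(1) by force
  show "t \<le> left_end x" using left_end_greatest[OF ax] assms by auto
  show "left_end x \<le> t" using sigma_le[OF left_end_in[OF ax], of t] left_end_le[OF ax] assms by force
qed

section \<open>Rd-continuous functions\<close>

abbreviation rd :: "real set \<Rightarrow> (real \<Rightarrow> real) \<Rightarrow> bool" where
  "rd \<equiv> rd_continuous_on J"

lemma rd_right: "rd S g \<Longrightarrow> t \<in> S \<Longrightarrow> sigma J t = t \<Longrightarrow> continuous (at t within S) g"
  by (simp add: rd_continuous_on_def)

text \<open>At left-scattered points the left limit is over the trivial filter, so that left limits of
  rd-continuous functions exist at every point of the domain (\<open>rd_left\<close>).\<close>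
lemma left_scattered_at_within:
  assumes "t \<in> J" "rho J t \<noteq> t" "S \<subseteq> J"
  shows "at t within (S \<inter> {..<t}) = bot"
proof -
  have "\<forall>\<^sub>F x in at t within (S \<inter> {..<t}). False"
    unfolding eventually_at
  proof (intro exI[of _ "t - rho J t"] conjI ballI impI)
    show "0 < t - rho J t" using left_scattered(2)[OF assms(1,2)] by simp
    fix x assume "x \<in> S \<inter> {..<t}" "x \<noteq> t \<and> dist x t < t - rho J t"
    then show False using left_scattered(3)[OF assms(1,2), of x] assms(3) by (auto simp: dist_real_def)
  qed
  then show ?thesis by (simp add: eventually_False)
qed

lemma rd_left:
  assumes "rd S g" "S \<subseteq> J" "t \<in> S"
  shows "\<exists>l. (g \<longlongrightarrow> l) (at t within (S \<inter> {..<t}))"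
proof (cases "rho J t = t")
  case True
  then show ?thesis using assms by (simp add: rd_continuous_on_def)
next
  case False
  then show ?thesis using left_scattered_at_within[of t S] assms by auto
qed

lemma rd_subset: "rd S g \<Longrightarrow> S' \<subseteq> S \<Longrightarrow> rd S' g"
  unfolding rd_continuous_on_def
  by (meson Int_mono continuous_within_subset order_refl subsetD tendsto_within_subset)

lemma rd_cong:
  assumes "rd S g" "\<And>t. t \<in> S \<Longrightarrow> h t = g t"
  shows "rd S h"
  unfolding rd_continuous_on_def
proof (intro conjI ballI impI)
  fix t assume t: "t \<in> S"
  {
    assume "sigma J t = t"
    then have "continuous (at t within S) g" using rd_right assms(1) t by blast
    then show "continuous (at t within S) h"
      by (rule continuous_transform_within[OF _ zero_less_one t]) (simp add: assms(2))
  }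
  {
    assume "rho J t = t"
    then obtain l where l: "(g \<longlongrightarrow> l) (at t within (S \<inter> {..<t}))"
      using assms(1) t unfolding rd_continuous_on_def by blast
    have "(h \<longlongrightarrow> l) (at t within (S \<inter> {..<t}))"
      by (rule Lim_transform_within[OF l zero_less_one]) (simp add: assms(2))
    then show "\<exists>l. (h \<longlongrightarrow> l) (at t within (S \<inter> {..<t}))" by blast
  }
qed

lemma rd_mult:
  assumes "rd S g" "rd S h" shows "rd S (\<lambda>t. g t * h t)"
  unfolding rd_continuous_on_def
proof (intro conjI ballI impI)
  fix t assume "t \<in> S" "sigma J t = t"
  then show "continuous (at t within S) (\<lambda>t. g t * h t)"
    using assms by (intro continuous_mult rd_right)
next
  fix t assume "t \<in> S" "rho J t = t"
  then obtain k l where "(g \<longlongrightarrow> k) (at t within (S \<inter> {..<t}))" "(h \<longlongrightarrow> l) (at t within (S \<inter> {..<t}))"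
    using assms unfolding rd_continuous_on_def by blast
  then show "\<exists>l. ((\<lambda>t. g t * h t) \<longlongrightarrow> l) (at t within (S \<inter> {..<t}))"
    using tendsto_mult by blast
qed

lemma rd_diff:
  assumes "rd S g" "rd S h" shows "rd S (\<lambda>t. g t - h t)"
  unfolding rd_continuous_on_def
proof (intro conjI ballI impI)
  fix t assume "t \<in> S" "sigma J t = t"
  then show "continuous (at t within S) (\<lambda>t. g t - h t)"
    using assms by (intro continuous_diff rd_right)
next
  fix t assume "t \<in> S" "rho J t = t"
  then obtain k l where "(g \<longlongrightarrow> k) (at t within (S \<inter> {..<t}))" "(h \<longlongrightarrow> l) (at t within (S \<inter> {..<t}))"
    using assms unfolding rd_continuous_on_def by blast
  then show "\<exists>l. ((\<lambda>t. g t - h t) \<longlongrightarrow> l) (at t within (S \<inter> {..<t}))"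
    using tendsto_diff by blast
qed

lemma rd_const: "rd S (\<lambda>t. c)"
  unfolding rd_continuous_on_def by (auto intro: tendsto_const)

text \<open>A positive lower bound, and not only the absence of zeros, is needed for the left limit of the
  reciprocal.\<close>
lemma rd_inverse:
  assumes "rd S g" "c > 0" "\<And>t. t \<in> S \<Longrightarrow> c \<le> \<bar>g t\<bar>"
  shows "rd S (\<lambda>t. inverse (g t))"
  unfolding rd_continuous_on_def
proof (intro conjI ballI impI)
  fix t assume t: "t \<in> S"
  {
    assume "sigma J t = t"
    then have "continuous (at t within S) g" using rd_right assms(1) t by blast
    moreover have "g t \<noteq> 0" using assms(2,3) t by force
    ultimately show "continuous (at t within S) (\<lambda>t. inverse (g t))"
      by (rule continuous_at_within_inverse)
  }
  {
    assume "rho J t = t"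
    then obtain l where l: "(g \<longlongrightarrow> l) (at t within (S \<inter> {..<t}))" (is "(_ \<longlongrightarrow> _) ?F")
      using assms(1) t unfolding rd_continuous_on_def by blast
    show "\<exists>l. ((\<lambda>t. inverse (g t)) \<longlongrightarrow> l) ?F"
    proof (cases "?F = bot")
      case False
      have "\<forall>\<^sub>F s in ?F. c \<le> \<bar>g s\<bar>"
        using assms(3) by (auto simp: eventually_at intro!: exI[of _ 1])
      then have "c \<le> \<bar>l\<bar>" by (rule tendsto_lowerbound[OF tendsto_rabs[OF l] _ False])
      then have "l \<noteq> 0" using assms(2) by auto
      then show ?thesis using tendsto_inverse[OF l] by blast
    qed simp
  }
qed

text \<open>To the right of a point the function is either continuous or has no arguments nearby; to the left it
  has a limit.\<close>
lemma rd_locally_bounded: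
  assumes "rd S g" "S \<subseteq> J" "t \<in> S"
  shows "\<exists>e>0. \<exists>M. \<forall>s\<in>S. \<bar>s - t\<bar> < e \<longrightarrow> \<bar>g s\<bar> \<le> M"
proof -
  have tJ: "t \<in> J" using assms by auto
  have "\<exists>e>0. \<exists>M. \<forall>s\<in>S. t \<le> s \<and> s < t + e \<longrightarrow> \<bar>g s\<bar> \<le> M"
  proof (cases "sigma J t = t")
    case True
    then have "continuous (at t within S) g" using rd_right assms by blast
    then obtain d where d: "d > 0" "\<And>s. s \<in> S \<Longrightarrow> dist s t < d \<Longrightarrow> dist (g s) (g t) < 1"
      unfolding continuous_within_eps_delta using zero_less_one by blast
    have "\<bar>g s\<bar> \<le> \<bar>g t\<bar> + 1" if "s \<in> S" "t \<le> s \<and> s < t + d" for s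
      using d(2)[of s] that by (auto simp: dist_real_def)
    then show ?thesis using d(1) by blast
  next
    case False
    then have "sigma J t - t > 0" using sigma_ge[OF tJ] by simp
    moreover have "\<bar>g s\<bar> \<le> \<bar>g t\<bar>" if "s \<in> S" "t \<le> s \<and> s < t + (sigma J t - t)" for s
    proof (cases "s = t")
      case False
      then have "sigma J t \<le> s" using that assms(2) by (intro sigma_le) auto
      then show ?thesis using that by auto
    qed simp
    ultimately show ?thesis by blast
  qed
  then obtain e M where r: "e > 0" "\<And>s. s \<in> S \<Longrightarrow> t \<le> s \<Longrightarrow> s < t + e \<Longrightarrow> \<bar>g s\<bar> \<le> M" by blast
  obtain l where "(g \<longlongrightarrow> l) (at t within (S \<inter> {..<t}))" using rd_left assms by blast
  then have "\<forall>\<^sub>F s in at t within (S \<inter> {..<t}). dist (g s) l < 1" by (rule tendstoD) simp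
  then obtain d where d: "d > 0" "\<And>s. s \<in> S \<inter> {..<t} \<Longrightarrow> s \<noteq> t \<and> dist s t < d \<Longrightarrow> dist (g s) l < 1"
    unfolding eventually_at by blast
  have "\<bar>g s\<bar> \<le> max M (\<bar>l\<bar> + 1)" if "s \<in> S" "\<bar>s - t\<bar> < min e d" for s
  proof (cases "s < t")
    case True
    then have "dist (g s) l < 1" using that by (intro d(2)) (auto simp: dist_real_def)
    then show ?thesis by (auto simp: dist_real_def)
  next
    case False
    then have "\<bar>g s\<bar> \<le> M" using that by (intro r(2)) auto
    then show ?thesis by simp
  qed
  moreover have "min e d > 0" using r(1) d(1) by simp
  ultimately show ?thesis by blast
qed

lemma rd_bounded:
  assumes "rd S g" "closed S" "S \<subseteq> J"
  shows "\<exists>B. \<forall>t\<in>S. \<bar>g t\<bar> \<le> B"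
proof (rule ccontr)
  assume "\<not> ?thesis"
  then have "\<forall>n::nat. \<exists>t\<in>S. real n < \<bar>g t\<bar>" by (meson not_le)
  then obtain X where X: "\<And>n::nat. X n \<in> S" "\<And>n. real n < \<bar>g (X n)\<bar>" by metis
  have "compact S" using assms J_subset bounded_subset[of "{a..b}" S] by (auto simp: compact_eq_bounded_closed)
  then obtain l r where l: "l \<in> S" "strict_mono r" "(X \<circ> r) \<longlonglongrightarrow> l"
    using X(1) unfolding compact_def by metis
  obtain e M where e: "e > 0" "\<And>s. s \<in> S \<Longrightarrow> \<bar>s - l\<bar> < e \<Longrightarrow> \<bar>g s\<bar> \<le> M"
    using rd_locally_bounded[OF assms(1,3) l(1)] by blast
  have "\<forall>\<^sub>F n in sequentially. dist ((X \<circ> r) n) l < e" using tendstoD[OF l(3) e(1)] .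
  moreover have "\<forall>\<^sub>F n in sequentially. nat \<lceil>M\<rceil> \<le> n" by (rule eventually_ge_at_top)
  ultimately have "\<forall>\<^sub>F n::nat in sequentially. False"
  proof eventually_elim
    case (elim n)
    have "\<bar>g (X (r n))\<bar> \<le> M" using elim X(1) by (intro e(2)) (auto simp: dist_real_def)
    moreover have "M \<le> real n" using elim by linarith
    moreover have "real n \<le> real (r n)" using seq_suble[OF l(2)] by simp
    ultimately show False using X(2)[of "r n"] by linarith
  qed
  then show False by simp
qed

text \<open>At a right-dense point of \<open>J\<close> the composition with the retraction is right-continuous because \<open>g\<close> is
  continuous there; every other point starts an interval on which the composition is constant. The
  factor that vanishes outside \<open>[a, t)\<close> extends this to the whole line.\<close>
lemma rd_measurable:
  assumes "rd (J \<inter> {a..<t}) g" "t \<le> b"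
  shows "(\<lambda>y. indicator {a..<t} y * g (left_end y)) \<in> borel_measurable borel"
proof (rule right_continuous_imp_borel_measurable)
  fix y
  let ?E = "\<lambda>y. indicator {a..<t} y * g (left_end y)"
  have const: "(?E \<longlongrightarrow> ?E y) (at_right y)" if "c > y" "\<And>x. y < x \<Longrightarrow> x < c \<Longrightarrow> ?E x = ?E y" for c
  proof (rule tendsto_eventually)
    show "\<forall>\<^sub>F x in at_right y. ?E x = ?E y"
      unfolding eventually_at_right_field using that by blast
  qed
  show "(?E \<longlongrightarrow> ?E y) (at_right y)"
  proof (cases "a \<le> y \<and> y < t")
    case False
    show ?thesis
      by (rule const[of "if y < a then a else y + 1"]) (use False in \<open>auto simp: indicator_def\<close>)
  next
    case True
    then have ay: "a \<le> y" and yt: "y < t" and yb: "y < b" using assms(2) by auto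
    from less_sigma_left_end[OF ay yb] show ?thesis
    proof
      assume ys: "y < sigma J (left_end y)"
      show ?thesis
      proof (rule const[of "min t (sigma J (left_end y))"])
        fix x assume x: "y < x" "x < min t (sigma J (left_end y))"
        then have "left_end x = left_end y" using left_end_in[OF ay] left_end_le[OF ay] by (intro left_end_eqI) auto
        then show "?E x = ?E y" using x ay yt by simp
      qed (use ys yt in simp)
    next
      assume dense: "sigma J (left_end y) = left_end y \<and> left_end y = y"
      then have yJ: "y \<in> J \<inter> {a..<t}" using left_end_in[OF ay] ay yt by auto
      then have cont: "continuous (at y within (J \<inter> {a..<t})) g"
        using dense by (intro rd_right[OF assms(1)]) auto
      show ?thesis
      proof (rule tendstoI)
        fix e :: real assume "e > 0"
        then obtain d where d: "d > 0" "\<And>s. s \<in> J \<inter> {a..<t} \<Longrightarrow> dist s y < d \<Longrightarrow> dist (g s) (g y) < e"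
          using cont unfolding continuous_within_eps_delta by blast
        have "dist (?E x) (?E y) < e" if x: "y < x" "x < min t (y + d)" for x
        proof -
          have ax: "a \<le> x" using x ay by simp
          have "y \<le> left_end x" "left_end x \<le> x" "left_end x \<in> J"
            using left_end_greatest[OF ax, of y] left_end_in[OF ax] left_end_le[OF ax] yJ x by auto
          then have "dist (g (left_end x)) (g y) < e"
            using x ay by (intro d(2)) (auto simp: dist_real_def)
          then show ?thesis using x ax ay yt dense by simp
        qed
        then show "\<forall>\<^sub>F x in at_right y. dist (?E x) (?E y) < e"
          unfolding eventually_at_right_field using d(1) yt by (intro exI[of _ "min t (y + d)"]) auto
      qed
    qed
  qed
qed

section \<open>The delta integral as a Lebesgue integral\<close>

text \<open>The interval is half-open so that, for end points in \<open>J\<close>, only values at points of \<open>J\<close> strictly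
  below \<open>t\<close> enter and additivity is exact.\<close>
definition delta_int :: "real \<Rightarrow> real \<Rightarrow> (real \<Rightarrow> real) \<Rightarrow> real" where
  "delta_int s t g = (LINT y|lborel. indicator {s..<t} y * g (left_end y))"

text \<open>A class of integrands that contains the rd-continuous functions on \<open>kappa J\<close> and is, unlike these,
  closed under bounded pointwise limits.\<close>
definition cell_integrable :: "real \<Rightarrow> (real \<Rightarrow> real) \<Rightarrow> bool" where
  "cell_integrable t g \<longleftrightarrow> (\<lambda>y. indicator {a..<t} y * g (left_end y)) \<in> borel_measurable borel \<and>
     (\<exists>B. \<forall>\<eta>\<in>J \<inter> {a..<t}. \<bar>g \<eta>\<bar> \<le> B)"

lemma cell_integrable_measurable:
  "cell_integrable t g \<Longrightarrow> (\<lambda>y. indicator {a..<t} y * g (left_end y)) \<in> borel_measurable borel"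
  by (simp add: cell_integrable_def)

lemma cell_integrable_bound: "cell_integrable t g \<Longrightarrow> \<exists>B\<ge>0. \<forall>\<eta>\<in>J \<inter> {a..<t}. \<bar>g \<eta>\<bar> \<le> B"
  unfolding cell_integrable_def by (meson abs_ge_zero abs_ge_self order_trans)

lemma left_end_in_cell: "a \<le> s \<Longrightarrow> s \<in> J \<Longrightarrow> s \<le> y \<Longrightarrow> y < t \<Longrightarrow> left_end y \<in> J \<inter> {s..<t}"
  using left_end_in[of y] left_end_le[of y] left_end_greatest[of y s] by auto

lemma cell_integrable_rd:
  assumes "rd S g" "closed S" "S \<subseteq> J" "J \<inter> {a..<t} \<subseteq> S" "t \<le> b"
  shows "cell_integrable t g"
  unfolding cell_integrable_def
  using rd_measurable[OF rd_subset[OF assms(1,4)] assms(5)] rd_bounded[OF assms(1-3)] assms(4)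
  by blast

lemma cell_integrable_mono:
  assumes "cell_integrable t g" "t' \<le> t" shows "cell_integrable t' g"
proof -
  have "(\<lambda>y. indicator {a..<t'} y * (indicator {a..<t} y * g (left_end y))) \<in> borel_measurable borel"
    using cell_integrable_measurable[OF assms(1)] by measurable
  moreover have "(\<lambda>y. indicator {a..<t'} y * (indicator {a..<t} y * g (left_end y))) =
      (\<lambda>y. indicator {a..<t'} y * g (left_end y))"
    using assms(2) by (auto simp: indicator_def)
  ultimately show ?thesis using assms unfolding cell_integrable_def by (fastforce)
qed

lemma cell_integrable_mult:
  assumes "cell_integrable t g" "cell_integrable t h" shows "cell_integrable t (\<lambda>x. g x * h x)"
proof -
  obtain B C where B: "\<And>\<eta>. \<eta> \<in> J \<inter> {a..<t} \<Longrightarrow> \<bar>g \<eta>\<bar> \<le> B" "\<And>\<eta>. \<eta> \<in> J \<inter> {a..<t} \<Longrightarrow> \<bar>h \<eta>\<bar> \<le> C"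
    using assms unfolding cell_integrable_def by blast
  have "(\<lambda>y. (indicator {a..<t} y * g (left_end y)) * (indicator {a..<t} y * h (left_end y))) \<in> borel_measurable borel"
    using assms by (intro borel_measurable_times cell_integrable_measurable)
  also have "(\<lambda>y. (indicator {a..<t} y * g (left_end y)) * (indicator {a..<t} y * h (left_end y))) =
      (\<lambda>y. indicator {a..<t} y * (g (left_end y) * h (left_end y)))"
    by (auto simp: indicator_def)
  finally have "(\<lambda>y. indicator {a..<t} y * (g (left_end y) * h (left_end y))) \<in> borel_measurable borel" .
  moreover have "\<bar>g \<eta> * h \<eta>\<bar> \<le> B * C" if "\<eta> \<in> J \<inter> {a..<t}" for \<eta>
    unfolding abs_mult by (intro mult_mono' B that) auto
  ultimately show ?thesis unfolding cell_integrable_def by blast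
qed

lemma cell_integrable_diff:
  assumes "cell_integrable t g" "cell_integrable t h" shows "cell_integrable t (\<lambda>x. g x - h x)"
proof -
  obtain B C where B: "\<And>\<eta>. \<eta> \<in> J \<inter> {a..<t} \<Longrightarrow> \<bar>g \<eta>\<bar> \<le> B" "\<And>\<eta>. \<eta> \<in> J \<inter> {a..<t} \<Longrightarrow> \<bar>h \<eta>\<bar> \<le> C"
    using assms unfolding cell_integrable_def by blast
  have "(\<lambda>y. indicator {a..<t} y * g (left_end y) - indicator {a..<t} y * h (left_end y)) \<in> borel_measurable borel"
    using assms by (intro borel_measurable_diff cell_integrable_measurable)
  then have "(\<lambda>y. indicator {a..<t} y * (g (left_end y) - h (left_end y))) \<in> borel_measurable borel"
    by (simp add: right_diff_distrib)
  moreover have "\<bar>g \<eta> - h \<eta>\<bar> \<le> B + C" if "\<eta> \<in> J \<inter> {a..<t}" for \<eta>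
    using B[OF that] by linarith
  ultimately show ?thesis unfolding cell_integrable_def by blast
qed

lemma cell_integrable_const: "cell_integrable t (\<lambda>x. c)"
  unfolding cell_integrable_def by auto

lemma integrable_step:
  assumes "cell_integrable u g" "a \<le> s" "t \<le> u"
  shows "integrable lborel (\<lambda>y. indicator {s..<t} y * g (left_end y))"
proof -
  obtain B where B: "B \<ge> 0" "\<And>\<eta>. \<eta> \<in> J \<inter> {a..<u} \<Longrightarrow> \<bar>g \<eta>\<bar> \<le> B"
    using cell_integrable_bound[OF assms(1)] by blast
  have "(\<lambda>y. indicator {s..<t} y * (indicator {a..<u} y * g (left_end y))) \<in> borel_measurable borel"
    using cell_integrable_measurable[OF assms(1)] by measurable
  also have "(\<lambda>y. indicator {s..<t} y * (indicator {a..<u} y * g (left_end y))) = (\<lambda>y. indicator {s..<t} y * g (left_end y))"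
    using assms(2,3) by (auto simp: indicator_def)
  finally have m: "(\<lambda>y. indicator {s..<t} y * g (left_end y)) \<in> borel_measurable lborel" by simp
  have i: "integrable lborel (\<lambda>y. indicator {s..<t} y * B)" by (cases "s \<le> t") auto
  show ?thesis
  proof (rule Bochner_Integration.integrable_bound[OF i m AE_I2])
    fix y
    show "norm (indicator {s..<t} y * g (left_end y)) \<le> norm (indicator {s..<t} y * B)"
      using B(1) B(2)[of "left_end y"] left_end_in_cell[of a y u] a_in assms(2,3) by (auto simp: indicator_def)
  qed
qed

lemma delta_int_split:
  assumes "cell_integrable t g" "a \<le> r" "r \<le> s" "s \<le> t"
  shows "delta_int r t g = delta_int r s g + delta_int s t g"
proof -
  have "delta_int r t g = (LINT y|lborel. indicator {r..<s} y * g (left_end y) + indicator {s..<t} y * g (left_end y))"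
    unfolding delta_int_def using assms by (intro Bochner_Integration.integral_cong) (auto simp: indicator_def)
  also have "\<dots> = delta_int r s g + delta_int s t g"
    unfolding delta_int_def using assms
    by (intro Bochner_Integration.integral_add integrable_step[OF assms(1)]) auto
  finally show ?thesis .
qed

lemma delta_int_diff:
  assumes "cell_integrable t g" "cell_integrable t h" "a \<le> s"
  shows "delta_int s t (\<lambda>x. g x - h x) = delta_int s t g - delta_int s t h"
  unfolding delta_int_def right_diff_distrib
  by (intro Bochner_Integration.integral_diff integrable_step[OF assms(1)] integrable_step[OF assms(2)] assms(3) order_refl)

lemma delta_int_const: "s \<le> t \<Longrightarrow> delta_int s t (\<lambda>x. c) = c * (t - s)"
  unfolding delta_int_def by simp

lemma delta_int_cmult: "delta_int s t (\<lambda>x. c * g x) = c * delta_int s t g"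
  unfolding delta_int_def by (subst Bochner_Integration.integral_mult_right_zero[symmetric])
    (simp add: ac_simps)

lemma delta_int_cong:
  assumes "s \<in> J" "\<And>\<eta>. \<eta> \<in> J \<inter> {s..<t} \<Longrightarrow> g \<eta> = h \<eta>"
  shows "delta_int s t g = delta_int s t h"
  unfolding delta_int_def
proof (rule Bochner_Integration.integral_cong[OF refl])
  fix y
  show "indicator {s..<t} y * g (left_end y) = indicator {s..<t} y * h (left_end y)"
    using assms(2)[of "left_end y"] left_end_in_cell[of s y t] assms(1) J_bounds(1) by (auto simp: indicator_def)
qed

lemma delta_int_refl [simp]: "delta_int s s g = 0"
  unfolding delta_int_def by simp

text \<open>On a gap the integrand is frozen at the left end point. This is where the term
  \<open>(\<sigma> t - t) * g t\<close> of \<Delta>-integration comes from.\<close>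
lemma delta_int_cell:
  assumes "t \<in> J" shows "delta_int t (sigma J t) g = g t * (sigma J t - t)"
proof -
  have "delta_int t (sigma J t) g = delta_int t (sigma J t) (\<lambda>x. g t)"
  proof (rule delta_int_cong[OF assms])
    fix \<eta> assume "\<eta> \<in> J \<inter> {t..<sigma J t}"
    then have "\<eta> = t" using sigma_le[of \<eta> t] by force
    then show "g \<eta> = g t" by simp
  qed
  then show ?thesis using delta_int_const sigma_ge[OF assms] by simp
qed

lemma delta_int_bound:
  assumes "cell_integrable t g" "s \<in> J" "s \<le> t" "\<And>\<eta>. \<eta> \<in> J \<inter> {s..<t} \<Longrightarrow> \<bar>g \<eta>\<bar> \<le> B"
  shows "\<bar>delta_int s t g\<bar> \<le> B * (t - s)"
proof -
  have "\<bar>delta_int s t g\<bar> \<le> (LINT y|lborel. indicator {s..<t} y * B)"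
    unfolding delta_int_def
  proof (rule integral_abs_bound_integral)
    show "integrable lborel (\<lambda>y. indicator {s..<t} y * g (left_end y))"
      using integrable_step[OF assms(1)] J_bounds(1)[OF assms(2)] by auto
    show "integrable lborel (\<lambda>y. indicator {s..<t} y * B)" using assms(3) by auto
    show "\<bar>indicator {s..<t} y * g (left_end y)\<bar> \<le> indicator {s..<t} y * B" for y
      using assms(4)[of "left_end y"] left_end_in_cell[of s y t] assms(2) J_bounds(1) by (auto simp: indicator_def)
  qed
  also have "\<dots> = B * (t - s)" using assms(3) by simp
  finally show ?thesis .
qed

end

section \<open>Delta derivatives and the fundamental theorem\<close>

lemma has_delta_derivative_subset:
  "has_delta_derivative T S g l t \<Longrightarrow> S' \<subseteq> S \<Longrightarrow> has_delta_derivative T S' g l t"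
  unfolding has_delta_derivative_def by (meson Int_mono order_refl subsetD)

lemma has_delta_derivative_add:
  assumes "has_delta_derivative T S g l t" "has_delta_derivative T S h k t"
  shows "has_delta_derivative T S (\<lambda>x. g x + h x) (l + k) t"
  unfolding has_delta_derivative_def
proof (intro allI impI)
  fix e :: real assume "e > 0"
  then have e: "e / 2 > 0" by simp
  obtain U where U: "open U" "t \<in> U"
    "\<And>s. s \<in> U \<inter> S \<Longrightarrow> \<bar>(g (sigma T t) - g s) - l * (sigma T t - s)\<bar> \<le> e / 2 * \<bar>sigma T t - s\<bar>"
    using assms(1) e unfolding has_delta_derivative_def by meson
  obtain V where V: "open V" "t \<in> V"
    "\<And>s. s \<in> V \<inter> S \<Longrightarrow> \<bar>(h (sigma T t) - h s) - k * (sigma T t - s)\<bar> \<le> e / 2 * \<bar>sigma T t - s\<bar>"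
    using assms(2) e unfolding has_delta_derivative_def by meson
  show "\<exists>W. open W \<and> t \<in> W \<and> (\<forall>s\<in>W \<inter> S. \<bar>(g (sigma T t) + h (sigma T t) - (g s + h s))
      - (l + k) * (sigma T t - s)\<bar> \<le> e * \<bar>sigma T t - s\<bar>)"
  proof (intro exI[of _ "U \<inter> V"] conjI ballI)
    fix s assume s: "s \<in> U \<inter> V \<inter> S"
    have "\<bar>(g (sigma T t) - g s) - l * (sigma T t - s)\<bar> \<le> e / 2 * \<bar>sigma T t - s\<bar>" using U(3) s by blast
    moreover have "\<bar>(h (sigma T t) - h s) - k * (sigma T t - s)\<bar> \<le> e / 2 * \<bar>sigma T t - s\<bar>" using V(3) s by blast
    moreover have "(g (sigma T t) + h (sigma T t) - (g s + h s)) - (l + k) * (sigma T t - s) =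
        ((g (sigma T t) - g s) - l * (sigma T t - s)) + ((h (sigma T t) - h s) - k * (sigma T t - s))"
      by (simp add: algebra_simps)
    ultimately show "\<bar>(g (sigma T t) + h (sigma T t) - (g s + h s))
      - (l + k) * (sigma T t - s)\<bar> \<le> e * \<bar>sigma T t - s\<bar>" by linarith
  qed (use U V in auto)
qed

lemma has_delta_derivative_uminus:
  assumes "has_delta_derivative T S g l t"
  shows "has_delta_derivative T S (\<lambda>x. - g x) (- l) t"
proof -
  have eq: "\<bar>(- g (sigma T t) - - g s) - - l * (sigma T t - s)\<bar> =
      \<bar>(g (sigma T t) - g s) - l * (sigma T t - s)\<bar>" for s
    by (simp add: abs_if algebra_simps)
  show ?thesis using assms unfolding has_delta_derivative_def eq .
qed

lemma has_delta_derivative_diff: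
  assumes "has_delta_derivative T S g l t" "has_delta_derivative T S h k t"
  shows "has_delta_derivative T S (\<lambda>x. g x - h x) (l - k) t"
  using has_delta_derivative_add[OF assms(1) has_delta_derivative_uminus[OF assms(2)]] by simp

text \<open>At a right-dense point the \<Delta>-derivative is the ordinary derivative within the domain, and at a
  right-scattered point (next lemma) it is a difference quotient together with continuity. Later
  arguments distinguish these two cases.\<close>
lemma has_delta_derivative_right_dense:
  assumes "sigma T t = t"
  shows "has_delta_derivative T S g l t \<longleftrightarrow> (g has_field_derivative l) (at t within S)"
proof -
  have sym: "\<bar>(g t - g s) - l * (t - s)\<bar> \<le> e * \<bar>t - s\<bar> \<longleftrightarrow>
      norm (g s - g t - l * (s - t)) \<le> e * norm (s - t)" for s e
  proof -
    have "(g t - g s) - l * (t - s) = - (g s - g t - l * (s - t))" by (simp add: algebra_simps)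
    then show ?thesis by (metis abs_minus_cancel abs_minus_commute real_norm_def)
  qed
  have nbhd: "(\<exists>U. open U \<and> t \<in> U \<and> (\<forall>s\<in>U \<inter> S. P s)) \<longleftrightarrow>
      (\<exists>d>0. \<forall>s\<in>S. norm (s - t) < d \<longrightarrow> P s)" for P
  proof
    assume "\<exists>U. open U \<and> t \<in> U \<and> (\<forall>s\<in>U \<inter> S. P s)"
    then obtain U where "open U" "t \<in> U" "\<forall>s\<in>U \<inter> S. P s" by blast
    then show "\<exists>d>0. \<forall>s\<in>S. norm (s - t) < d \<longrightarrow> P s"
      by (metis IntI dist_norm open_dist)
  next
    assume "\<exists>d>0. \<forall>s\<in>S. norm (s - t) < d \<longrightarrow> P s"
    then obtain d where "d > 0" "\<forall>s\<in>S. norm (s - t) < d \<longrightarrow> P s" by blast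
    then show "\<exists>U. open U \<and> t \<in> U \<and> (\<forall>s\<in>U \<inter> S. P s)"
      by (intro exI[of _ "ball t d"]) (auto simp: dist_norm norm_minus_commute)
  qed
  show ?thesis
    unfolding has_delta_derivative_def has_field_derivative_def has_derivative_within_alt assms sym nbhd
    by (simp add: bounded_linear_mult_right)
qed

lemma has_delta_derivative_right_scattered:
  assumes "t < sigma T t" "t \<in> S"
  shows "has_delta_derivative T S g l t \<longleftrightarrow>
    g (sigma T t) - g t = l * (sigma T t - t) \<and> continuous (at t within S) g"
proof -
  define m where "m = sigma T t - t"
  have m: "m > 0" using assms by (simp add: m_def)
  have st: "sigma T t = t + m" by (simp add: m_def)
  show ?thesis
  proof (intro iffI conjI)
    assume D: "has_delta_derivative T S g l t"
    \<comment> \<open>the defining inequality at the point \<open>t\<close> itself, for every \<open>e\<close>, forces equality\<close>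
    have near: "\<bar>g (t + m) - g t - l * m\<bar> \<le> e * m" if "e > 0" for e
    proof -
      obtain U where "t \<in> U" "\<And>s. s \<in> U \<inter> S \<Longrightarrow> \<bar>(g (t + m) - g s) - l * (t + m - s)\<bar> \<le> e * \<bar>t + m - s\<bar>"
        using D \<open>e > 0\<close> unfolding has_delta_derivative_def st by meson
      from this(2)[of t] this(1) show ?thesis using assms(2) m by auto
    qed
    have eq: "g (t + m) - g t - l * m = 0"
    proof (rule ccontr)
      assume ne: "g (t + m) - g t - l * m \<noteq> 0"
      have "\<bar>g (t + m) - g t - l * m\<bar> \<le> \<bar>g (t + m) - g t - l * m\<bar> / (2 * m) * m"
        using ne m by (intro near) simp
      then show False using ne m by simp
    qed
    then show "g (sigma T t) - g t = l * (sigma T t - t)" by (simp add: st)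
    show "continuous (at t within S) g"
      unfolding continuous_within_eps_delta
    proof (intro allI impI)
      fix e :: real assume e: "e > 0"
      define c where "c = e / (4 * m)"
      have c: "c > 0" using e m by (simp add: c_def)
      obtain U where U: "open U" "t \<in> U"
        "\<And>s. s \<in> U \<inter> S \<Longrightarrow> \<bar>(g (t + m) - g s) - l * (t + m - s)\<bar> \<le> c * \<bar>t + m - s\<bar>"
        using D c unfolding has_delta_derivative_def st by meson
      obtain d where d: "d > 0" "ball t d \<subseteq> U" using U(1,2) open_contains_ball by blast
      define d' where "d' = min (min d m) (e / (2 * (\<bar>l\<bar> + 1)))"
      have d': "d' > 0" using d m e by (simp add: d'_def)
      have "dist (g s) (g t) < e" if s: "s \<in> S" "dist s t < d'" for s
      proof -
        have st: "\<bar>s - t\<bar> < d" "\<bar>s - t\<bar> < m" "\<bar>s - t\<bar> < e / (2 * (\<bar>l\<bar> + 1))"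
          using s(2) by (auto simp: d'_def dist_real_def)
        have "s \<in> U \<inter> S" using s st d(2) by (auto simp: dist_real_def)
        then have "\<bar>(g (t + m) - g s) - l * (t + m - s)\<bar> \<le> c * \<bar>t + m - s\<bar>" by (rule U(3))
        also have "\<dots> \<le> c * (2 * m)" using st c by (intro mult_left_mono) auto
        also have "\<dots> = e / 2" using m by (simp add: c_def)
        finally have "\<bar>(g (t + m) - g s) - l * (t + m - s)\<bar> \<le> e / 2" .
        moreover have "(g (t + m) - g s) - l * (t + m - s) = g t - g s - l * (t - s)"
          using eq by (simp add: algebra_simps)
        ultimately have 1: "\<bar>g t - g s - l * (t - s)\<bar> \<le> e / 2" by simp
        have "\<bar>l * (t - s)\<bar> \<le> (\<bar>l\<bar> + 1) * \<bar>s - t\<bar>"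
          unfolding abs_mult by (simp add: abs_minus_commute mult_right_mono)
        also have "\<dots> < e / 2"
        proof -
          have "\<bar>s - t\<bar> * (2 * (\<bar>l\<bar> + 1)) < e"
            using st(3) by (subst (asm) pos_less_divide_eq) auto
          then show ?thesis by (simp add: algebra_simps)
        qed
        finally have "\<bar>l * (t - s)\<bar> < e / 2" .
        then show ?thesis using 1 unfolding dist_real_def by linarith
      qed
      then show "\<exists>d>0. \<forall>s\<in>S. dist s t < d \<longrightarrow> dist (g s) (g t) < e" using d' by blast
    qed
  next
    assume R: "g (sigma T t) - g t = l * (sigma T t - t) \<and> continuous (at t within S) g"
    show "has_delta_derivative T S g l t"
      unfolding has_delta_derivative_def
    proof (intro allI impI)
      fix e :: real assume e: "e > 0"
      have "e * m / 4 > 0" using e m by simp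
      then obtain d where d: "d > 0" "\<And>s. s \<in> S \<Longrightarrow> dist s t < d \<Longrightarrow> dist (g s) (g t) < e * m / 4"
        using R unfolding continuous_within_eps_delta by blast
      define d' where "d' = min (min d (m / 2)) (e * m / (4 * (\<bar>l\<bar> + 1)))"
      have d': "d' > 0" using d m e by (simp add: d'_def)
      have "\<bar>(g (sigma T t) - g s) - l * (sigma T t - s)\<bar> \<le> e * \<bar>sigma T t - s\<bar>"
        if s: "s \<in> ball t d' \<inter> S" for s
      proof -
        have st': "\<bar>s - t\<bar> < d" "\<bar>s - t\<bar> < m / 2" "\<bar>s - t\<bar> < e * m / (4 * (\<bar>l\<bar> + 1))"
          using s by (auto simp: d'_def dist_real_def abs_minus_commute)
        have 1: "\<bar>g t - g s\<bar> < e * m / 4"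
          using d(2)[of s] s st' by (auto simp: dist_real_def abs_minus_commute)
        have "\<bar>l * (t - s)\<bar> \<le> (\<bar>l\<bar> + 1) * \<bar>s - t\<bar>"
          unfolding abs_mult by (simp add: abs_minus_commute mult_right_mono)
        also have "\<dots> < e * m / 4"
        proof -
          have "\<bar>s - t\<bar> * (4 * (\<bar>l\<bar> + 1)) < e * m"
            using st'(3) by (subst (asm) pos_less_divide_eq) auto
          then show ?thesis by (simp add: algebra_simps)
        qed
        finally have 2: "\<bar>l * (t - s)\<bar> < e * m / 4" .
        have "(g (sigma T t) - g s) - l * (sigma T t - s) = (g t - g s) - l * (t - s)"
          using R by (simp add: algebra_simps)
        moreover have "e * (m / 2) = 2 * (e * m / 4)" by simp
        ultimately have "\<bar>(g (sigma T t) - g s) - l * (sigma T t - s)\<bar> \<le> e * (m / 2)"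
          using 1 2 by linarith
        also have "\<dots> \<le> e * \<bar>sigma T t - s\<bar>"
        proof (rule mult_left_mono)
          have "s - t \<le> \<bar>s - t\<bar>" by (rule abs_ge_self)
          then have "m / 2 \<le> sigma T t - s" using st'(2) unfolding st by linarith
          also have "\<dots> \<le> \<bar>sigma T t - s\<bar>" by (rule abs_ge_self)
          finally show "m / 2 \<le> \<bar>sigma T t - s\<bar>" .
        qed (use e in simp)
        finally show ?thesis .
      qed
      then show "\<exists>U. open U \<and> t \<in> U \<and> (\<forall>s\<in>U \<inter> S.
          \<bar>(g (sigma T t) - g s) - l * (sigma T t - s)\<bar> \<le> e * \<bar>sigma T t - s\<bar>)"
        using d' by (intro exI[of _ "ball t d'"]) auto
    qed
  qed
qed

context compact_time_scale
begin

lemma has_delta_derivative_continuous: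
  assumes "has_delta_derivative J S g l t" "t \<in> S" "t \<in> J"
  shows "continuous (at t within S) g"
proof (cases "sigma J t = t")
  case True
  then show ?thesis using assms(1) has_delta_derivative_right_dense DERIV_continuous by blast
next
  case False
  then show ?thesis using assms has_delta_derivative_right_scattered[of t J S] sigma_ge[of t] by auto
qed

text \<open>Points of \<open>kappa J\<close> are exactly those that have points other than \<open>\<sigma> t\<close> in each neighbourhood, so that
  the defining inequality determines the derivative.\<close>
lemma has_delta_derivative_unique:
  assumes "has_delta_derivative J J g l t" "has_delta_derivative J J g k t" "t \<in> kappa J"
  shows "l = k"
proof (rule ccontr)
  assume ne: "l \<noteq> k"
  have tJ: "t \<in> J" using assms(3) kappa_subset by auto
  \<comment> \<open>the zero function would have the nonzero derivative \<open>l - k\<close>\<close>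
  have "has_delta_derivative J J (\<lambda>x. g x - g x) (l - k) t"
    by (rule has_delta_derivative_diff[OF assms(1,2)])
  then obtain U where U: "open U" "t \<in> U"
    "\<And>s. s \<in> U \<inter> J \<Longrightarrow> \<bar>0 - (l - k) * (sigma J t - s)\<bar> \<le> \<bar>l - k\<bar> / 2 * \<bar>sigma J t - s\<bar>"
    using ne unfolding has_delta_derivative_def
    by (metis (no_types, lifting) diff_self half_gt_zero zero_less_abs_iff right_minus_eq)
  obtain d where d: "d > 0" "ball t d \<subseteq> U" using U(1,2) open_contains_ball by blast
  have "\<exists>s\<in>U \<inter> J. s \<noteq> sigma J t"
  proof (cases "sigma J t = t")
    case False
    then show ?thesis using U tJ by (intro bexI[of _ t]) auto
  next
    case True
    have "\<exists>s\<in>J. s \<noteq> t \<and> \<bar>s - t\<bar> < d"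
    proof (cases "t = b")
      case True
      then have "rho J b = b" using assms(3) kappa_max by simp
      then obtain z where "z \<in> J" "b - d < z" "z < b"
        using left_dense_points[of b d] d(1) a_less_b b_in by auto
      then show ?thesis using True by (intro bexI[of _ z]) auto
    next
      case False
      then have "t < b" using J_bounds[OF tJ] by simp
      then obtain z where "z \<in> J" "t < z" "z < t + d"
        using right_dense_points[of t d] tJ \<open>sigma J t = t\<close> d(1) by auto
      then show ?thesis by (intro bexI[of _ z]) auto
    qed
    then obtain s where "s \<in> J" "s \<noteq> t" "\<bar>s - t\<bar> < d" by blast
    moreover have "s \<in> U" using calculation d(2) by (auto simp: dist_real_def)
    ultimately show ?thesis using True by auto
  qed
  then obtain s where s: "s \<in> U \<inter> J" "s \<noteq> sigma J t" by blast
  have "\<bar>l - k\<bar> * \<bar>sigma J t - s\<bar> \<le> \<bar>l - k\<bar> / 2 * \<bar>sigma J t - s\<bar>"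
    using U(3)[OF s(1)] by (simp add: abs_mult)
  then show False using ne s(2) by (simp add: mult_le_cancel_right)
qed

text \<open>Induction along the time scale. For each slack \<open>e\<close> the infimum \<open>c\<close> of the points that violate the
  estimate with \<open>L + e\<close> does not violate it: if \<open>c\<close> is left-dense, continuity carries the estimate up
  to \<open>c\<close>, and otherwise \<open>c\<close> is \<open>s\<close> or the successor of a point where the estimate holds. Hence
  violations accumulate at \<open>c\<close> from the right, which makes \<open>c\<close> right-dense and contradicts the bound on
  the derivative at \<open>c\<close>.\<close>
lemma mean_value_bound:
  assumes "s \<in> J" "t \<in> J" "s \<le> t" "0 \<le> L"
    and deriv: "\<And>\<eta>. \<eta> \<in> kappa J \<Longrightarrow> s \<le> \<eta> \<Longrightarrow> \<eta> \<le> t \<Longrightarrow>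
      \<exists>l. \<bar>l\<bar> \<le> L \<and> has_delta_derivative J (J \<inter> {s..t}) G l \<eta>"
  shows "\<bar>G t - G s\<bar> \<le> L * (t - s)"
proof -
  let ?S = "J \<inter> {s..t}"
  have approx: "\<bar>G t - G s\<bar> \<le> (L + e) * (t - s)" if e: "e > 0" for e
  proof (rule ccontr)
    assume neg: "\<not> ?thesis"
    define C where "C = {x \<in> ?S. \<not> \<bar>G x - G s\<bar> \<le> (L + e) * (x - s)}"
    have tC: "t \<in> C" using neg assms by (auto simp: C_def)
    define c where "c = Inf C"
    have CJ: "C \<subseteq> J" by (auto simp: C_def)
    have cJ: "c \<in> J" unfolding c_def using tC CJ by (intro Inf_in_J) auto
    have lower: "c \<le> x" if "x \<in> C" for x
      unfolding c_def using that bdd_J(1)[OF CJ] by (rule cInf_lower)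
    have ct: "c \<le> t" using lower tC by simp
    have sc: "s \<le> c" unfolding c_def using tC by (intro cInf_greatest) (auto simp: C_def)
    have below: "\<bar>G x - G s\<bar> \<le> (L + e) * (x - s)" if "x \<in> J" "s \<le> x" "x < c" for x
      using lower[of x] that ct by (auto simp: C_def)
    have at_c: "\<bar>G c - G s\<bar> \<le> (L + e) * (c - s)"
    proof (cases "c = s")
      case False
      then have sc': "s < c" using sc by simp
      show ?thesis
      proof (cases "rho J c = c")
        case left_dense: True
        then have "c \<in> kappa J" using in_kappa[OF cJ] kappa_max J_bounds(2)[OF cJ] by fastforce
        then have cont: "continuous (at c within ?S) G"
          using deriv[of c] has_delta_derivative_continuous[of ?S G _ c] sc ct cJ by auto
        show ?thesis
        proof (rule ccontr)
          assume no: "\<not> ?thesis"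
          define \<theta> where "\<theta> = \<bar>G c - G s\<bar> - (L + e) * (c - s)"
          have "\<theta> > 0" using no by (simp add: \<theta>_def)
          then obtain d where d: "d > 0" "\<And>x. x \<in> ?S \<Longrightarrow> dist x c < d \<Longrightarrow> dist (G x) (G c) < \<theta>"
            using cont unfolding continuous_within_eps_delta by blast
          have "a < c" using sc' J_bounds(1)[OF assms(1)] by simp
          then obtain x where x: "x \<in> J" "c - min d (c - s) < x" "x < c"
            using left_dense_points[OF cJ _ left_dense, of "min d (c - s)"] d(1) sc' by auto
          have "dist (G x) (G c) < \<theta>" using x ct by (intro d(2)) (auto simp: dist_real_def)
          moreover have "\<bar>G x - G s\<bar> \<le> (L + e) * (x - s)" using x by (intro below) auto
          moreover have "(L + e) * (x - s) \<le> (L + e) * (c - s)"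
            using x assms(4) e by (intro mult_left_mono) auto
          ultimately show False unfolding \<theta>_def dist_real_def by linarith
        qed
      next
        case False
        let ?p = "rho J c"
        note p = left_scattered[OF cJ False]
        have sp: "s \<le> ?p" using p(3) assms(1) sc' by simp
        have sig: "sigma J ?p = c"
        proof (rule antisym)
          show "sigma J ?p \<le> c" using p(2) cJ by (rule sigma_le[rotated])
          show "c \<le> sigma J ?p"
          proof (rule ccontr)
            assume "\<not> ?thesis"
            then have "sigma J ?p \<le> ?p" using p(3) sigma_in[OF p(1)] by simp
            then have "sigma J ?p = ?p" using sigma_ge[OF p(1)] by simp
            then obtain z where "z \<in> J" "?p < z" "z < ?p + (c - ?p)"
              using right_dense_points[OF p(1), of "c - ?p"] p(2) J_bounds(2)[OF cJ] by auto
            then show False using p(3)[of z] by simp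
          qed
        qed
        have "?p \<in> kappa J" using p J_bounds(2)[OF cJ] by (intro in_kappa) auto
        then obtain l where l: "\<bar>l\<bar> \<le> L" "has_delta_derivative J ?S G l ?p"
          using deriv sp p(2) ct by force
        have "G c - G ?p = l * (c - ?p)"
          using l(2) has_delta_derivative_right_scattered[of ?p J ?S G l] sig p sp ct by auto
        then have "\<bar>G c - G ?p\<bar> = \<bar>l\<bar> * (c - ?p)" using p(2) by (simp add: abs_mult)
        also have "\<dots> \<le> (L + e) * (c - ?p)" using l(1) e p(2) by (intro mult_right_mono) auto
        finally have "\<bar>G c - G ?p\<bar> \<le> (L + e) * (c - ?p)" .
        moreover have "\<bar>G ?p - G s\<bar> \<le> (L + e) * (?p - s)" using below p sp by blast
        moreover have "(L + e) * (c - s) = (L + e) * (c - ?p) + (L + e) * (?p - s)"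
          by (simp add: algebra_simps)
        ultimately show ?thesis by linarith
      qed
    qed simp
    then have cC: "c \<notin> C" by (simp add: C_def)
    then have ct': "c < t" using tC ct by (cases "c = t") auto
    have "sigma J c \<le> c"
    proof -
      have "sigma J c \<le> Inf C"
      proof (rule cInf_greatest)
        show "C \<noteq> {}" using tC by auto
        fix x assume "x \<in> C"
        then have "c < x" using lower[of x] cC by (cases "x = c") auto
        then show "sigma J c \<le> x" using \<open>x \<in> C\<close> CJ by (intro sigma_le) auto
      qed
      then show "sigma J c \<le> c" by (simp add: c_def)
    qed
    then have dense: "sigma J c = c" using sigma_ge[OF cJ] by simp
    have "c \<in> kappa J" using ct' J_bounds(2)[OF assms(2)] cJ by (intro in_kappa) auto
    then obtain l where l: "\<bar>l\<bar> \<le> L" "has_delta_derivative J ?S G l c" using deriv sc ct by blast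
    obtain U where U: "open U" "c \<in> U"
      "\<And>x. x \<in> U \<inter> ?S \<Longrightarrow> \<bar>(G c - G x) - l * (c - x)\<bar> \<le> e * \<bar>c - x\<bar>"
      using l(2) e unfolding has_delta_derivative_def dense by meson
    obtain d where d: "d > 0" "ball c d \<subseteq> U" using U(1,2) open_contains_ball by blast
    have "Inf C < c + d" using d(1) by (simp add: c_def)
    then obtain x where x: "x \<in> C" "x < c + d"
      using cInf_less_iff[OF _ bdd_J(1)[OF CJ]] tC by auto
    have cx: "c < x" using lower[OF x(1)] cC x(1) by (cases "x = c") auto
    have "x \<in> U \<inter> ?S" using x cx d(2) by (auto simp: C_def dist_real_def)
    then have "\<bar>(G c - G x) - l * (c - x)\<bar> \<le> e * (x - c)" using U(3) cx by fastforce
    moreover have "\<bar>l * (c - x)\<bar> \<le> L * (x - c)"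
      using l(1) cx by (auto simp: abs_mult intro: mult_right_mono)
    ultimately have "\<bar>G c - G x\<bar> \<le> e * (x - c) + L * (x - c)" by linarith
    moreover have "(L + e) * (x - s) = (L + e) * (c - s) + (e * (x - c) + L * (x - c))"
      by (simp add: algebra_simps)
    ultimately have "\<bar>G x - G s\<bar> \<le> (L + e) * (x - s)" using at_c by linarith
    then show False using x(1) by (simp add: C_def)
  qed
  show ?thesis
  proof (rule field_le_epsilon)
    fix e :: real assume e: "e > 0"
    \<comment> \<open>the summand \<open>1\<close> covers the case \<open>s = t\<close>\<close>
    have "\<bar>G t - G s\<bar> \<le> (L + e / (t - s + 1)) * (t - s)" using e assms(3) by (intro approx) simp
    also have "\<dots> = L * (t - s) + e * ((t - s) / (t - s + 1))" by (simp add: algebra_simps)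
    also have "\<dots> \<le> L * (t - s) + e * 1"
      using e assms(3) by (intro add_left_mono mult_left_mono) auto
    finally show "\<bar>G t - G s\<bar> \<le> L * (t - s) + e" by simp
  qed
qed

lemma delta_int_diff_endpoints:
  assumes "cell_integrable u g" "s \<in> J" "t \<in> J" "s \<le> t" "t \<le> u"
  shows "delta_int a t g - delta_int a s g = delta_int s t g"
  using delta_int_split[OF cell_integrable_mono[OF assms(1,5)], of a s] assms(4) J_bounds(1)[OF assms(2)] by simp

lemma delta_int_lipschitz:
  assumes "cell_integrable u g" "s \<in> J" "t \<in> J" "s \<le> u" "t \<le> u" "\<And>\<eta>. \<eta> \<in> J \<inter> {a..<u} \<Longrightarrow> \<bar>g \<eta>\<bar> \<le> B"
  shows "\<bar>delta_int a t g - delta_int a s g\<bar> \<le> B * \<bar>t - s\<bar>"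
proof -
  have *: "\<bar>delta_int a t g - delta_int a s g\<bar> \<le> B * \<bar>t - s\<bar>" if "s \<in> J" "t \<in> J" "s \<le> t" "t \<le> u" for s t
    unfolding delta_int_diff_endpoints[OF assms(1) that]
    using delta_int_bound[OF cell_integrable_mono[OF assms(1) that(4)] that(1,3), of B] assms(6) that J_bounds(1)[OF that(1)]
    by auto
  show ?thesis using *[of s t] *[of t s] assms by (cases "s \<le> t") (auto simp: abs_minus_commute)
qed

lemma continuous_if_lipschitz:
  fixes G :: "real \<Rightarrow> real"
  assumes "\<And>x. x \<in> S \<Longrightarrow> \<bar>G x - G t\<bar> \<le> B * \<bar>x - t\<bar>"
  shows "continuous (at t within S) G"
  unfolding continuous_within
proof (rule Lim_null[THEN iffD2], rule Lim_null_comparison)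
  show "\<forall>\<^sub>F x in at t within S. norm (G x - G t) \<le> B * \<bar>x - t\<bar>"
    using assms by (auto simp: eventually_at intro!: exI[of _ 1])
  have "((\<lambda>x. B * \<bar>x - t\<bar>) \<longlongrightarrow> B * \<bar>t - t\<bar>) (at t within S)" by (intro tendsto_intros)
  then show "((\<lambda>x. B * \<bar>x - t\<bar>) \<longlongrightarrow> 0) (at t within S)" by simp
qed

text \<open>The fundamental theorem. At right-scattered points the increment over the gap is explicit and the
  Lipschitz bound gives continuity; at right-dense points continuity of the integrand at \<open>\<eta>\<close> controls
  the integral between \<open>\<eta>\<close> and a nearby point of \<open>J\<close>, because the retraction stays between them. The
  domain \<open>S\<close> of \<open>g\<close> may be larger than the range of integration, because at a right-dense end point
  \<open>u\<close> continuity has to include the value \<open>g u\<close>.\<close>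
lemma delta_int_has_delta_derivative:
  assumes "cell_integrable u g" "\<eta> \<in> J" "sigma J \<eta> \<le> u"
    and cont: "sigma J \<eta> = \<eta> \<Longrightarrow> continuous (at \<eta> within S) g" and S: "J \<inter> {a..<u} \<subseteq> S"
  shows "has_delta_derivative J (J \<inter> {a..u}) (\<lambda>x. delta_int a x g) (g \<eta>) \<eta>"
proof (cases "sigma J \<eta> = \<eta>")
  case False
  have \<eta>u: "\<eta> \<le> u" using sigma_ge[OF assms(2)] assms(3) by simp
  obtain B where B: "\<And>\<eta>. \<eta> \<in> J \<inter> {a..<u} \<Longrightarrow> \<bar>g \<eta>\<bar> \<le> B" using assms(1) unfolding cell_integrable_def by blast
  have "continuous (at \<eta> within (J \<inter> {a..u})) (\<lambda>x. delta_int a x g)"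
    by (rule continuous_if_lipschitz[of _ _ _ B], rule delta_int_lipschitz[OF assms(1,2)])
      (use \<eta>u B in auto)
  moreover have "delta_int a (sigma J \<eta>) g - delta_int a \<eta> g = g \<eta> * (sigma J \<eta> - \<eta>)"
    using delta_int_diff_endpoints[OF assms(1,2) sigma_in[OF assms(2)] sigma_ge[OF assms(2)] assms(3)]
      delta_int_cell[OF assms(2)] by simp
  ultimately show ?thesis
    using has_delta_derivative_right_scattered[of \<eta> J] False sigma_ge[OF assms(2)] assms(2) \<eta>u J_bounds(1)
    by auto
next
  case True
  show ?thesis
    unfolding has_delta_derivative_def True
  proof (intro allI impI)
    fix e :: real assume e: "e > 0"
    obtain d where d: "d > 0" "\<And>x. x \<in> S \<Longrightarrow> dist x \<eta> < d \<Longrightarrow> dist (g x) (g \<eta>) < e"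
      using cont[OF True] e unfolding continuous_within_eps_delta by blast
    have main: "\<bar>(delta_int a t g - delta_int a s g) - g \<eta> * (t - s)\<bar> \<le> e * \<bar>t - s\<bar>"
      if st: "s \<in> J" "t \<in> J" "s \<le> t" "t \<le> u" "\<And>x. s \<le> x \<Longrightarrow> x < t \<Longrightarrow> dist x \<eta> < d" for s t
    proof -
      have di: "cell_integrable t g" using cell_integrable_mono[OF assms(1) st(4)] .
      have "(delta_int a t g - delta_int a s g) - g \<eta> * (t - s) = delta_int s t (\<lambda>x. g x - g \<eta>)"
        using delta_int_diff[OF di cell_integrable_const J_bounds(1)[OF st(1)]] delta_int_const[OF st(3)]
          delta_int_diff_endpoints[OF assms(1) st(1-4)] by simp
      also have "\<bar>\<dots>\<bar> \<le> e * (t - s)"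
      proof (rule delta_int_bound[OF cell_integrable_diff[OF di cell_integrable_const] st(1,3)])
        fix x assume x: "x \<in> J \<inter> {s..<t}"
        then have "x \<in> S" using S st(4) J_bounds(1)[OF st(1)] by auto
        then show "\<bar>g x - g \<eta>\<bar> \<le> e" using d(2)[of x] st(5)[of x] x by (auto simp: dist_real_def)
      qed
      finally show ?thesis using st(3) by simp
    qed
    have "\<bar>(delta_int a \<eta> g - delta_int a s g) - g \<eta> * (\<eta> - s)\<bar> \<le> e * \<bar>\<eta> - s\<bar>" if s: "s \<in> ball \<eta> d \<inter> (J \<inter> {a..u})" for s
    proof (cases "s \<le> \<eta>")
      case True
      then show ?thesis using s assms(2,3) sigma_ge[OF assms(2)] by (intro main) (auto simp: dist_real_def)
    next
      case False
      then have "\<bar>(delta_int a s g - delta_int a \<eta> g) - g \<eta> * (s - \<eta>)\<bar> \<le> e * \<bar>s - \<eta>\<bar>"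
        using s assms(2) by (intro main) (auto simp: dist_real_def)
      moreover have "(delta_int a \<eta> g - delta_int a s g) - g \<eta> * (\<eta> - s) = - ((delta_int a s g - delta_int a \<eta> g) - g \<eta> * (s - \<eta>))"
        by (simp add: algebra_simps)
      ultimately show ?thesis by (simp add: abs_minus_commute)
    qed
    then show "\<exists>U. open U \<and> \<eta> \<in> U \<and> (\<forall>s\<in>U \<inter> (J \<inter> {a..u}).
        \<bar>(delta_int a \<eta> g - delta_int a s g) - g \<eta> * (\<eta> - s)\<bar> \<le> e * \<bar>\<eta> - s\<bar>)"
      using d(1) by (intro exI[of _ "ball \<eta> d"]) auto
  qed
qed

lemma below_sigma_subset: "t \<in> J \<Longrightarrow> J \<inter> {a..<sigma J t} \<subseteq> kappa J \<inter> {a..t}"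
  using sigma_le[of _ t] sigma_bounds(2)[of t] by (force intro: in_kappa)

lemma delta_int_antiderivative:
  assumes "t \<in> J" "rd (kappa J \<inter> {a..t}) g" "\<eta> \<in> kappa J \<inter> {a..t}"
  shows "has_delta_derivative J (J \<inter> {a..sigma J t}) (\<lambda>x. delta_int a x g) (g \<eta>) \<eta>"
proof (rule delta_int_has_delta_derivative[where S = "kappa J \<inter> {a..t}"])
  show "cell_integrable (sigma J t) g"
    using assms kappa_subset sigma_bounds(2) below_sigma_subset
    by (intro cell_integrable_rd[OF assms(2)]) (auto intro: closed_Int closed_kappa)
  show \<eta>J: "\<eta> \<in> J" using assms kappa_subset by auto
  show "sigma J \<eta> \<le> sigma J t"
    using sigma_le[OF assms(1), of \<eta>] sigma_ge[OF assms(1)] assms(3) by (cases "\<eta> = t") auto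
  show "continuous (at \<eta> within kappa J \<inter> {a..t}) g" if "sigma J \<eta> = \<eta>"
    using rd_right[OF assms(2,3) that] .
qed (rule below_sigma_subset[OF assms(1)])

text \<open>Together with the next lemma, this identifies the integral defined by antiderivatives with the
  Lebesgue integral: existence is the fundamental theorem, uniqueness the mean value bound.\<close>
lemma has_delta_integral_delta_int:
  assumes "t \<in> J" "rd (kappa J \<inter> {a..t}) g"
  shows "has_delta_integral J g a t (delta_int a t g)"
  unfolding has_delta_integral_def
  using delta_int_antiderivative[OF assms] by (intro exI[of _ "\<lambda>x. delta_int a x g"]) simp

lemma has_delta_integral_unique:
  assumes "t \<in> J" "rd (kappa J \<inter> {a..t}) g" "has_delta_integral J g a t I"
  shows "I = delta_int a t g"
proof -
  obtain G where G: "\<And>\<eta>. \<eta> \<in> kappa J \<inter> {a..t} \<Longrightarrow> has_delta_derivative J (J \<inter> {a..sigma J t}) G (g \<eta>) \<eta>"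
    "I = G t - G a"
    using assms(3) unfolding has_delta_integral_def by blast
  have "\<bar>(G t - delta_int a t g) - (G a - delta_int a a g)\<bar> \<le> 0 * (t - a)"
  proof (rule mean_value_bound)
    fix \<eta> assume "\<eta> \<in> kappa J" "a \<le> \<eta>" "\<eta> \<le> t"
    then have "has_delta_derivative J (J \<inter> {a..sigma J t}) (\<lambda>x. G x - delta_int a x g) (g \<eta> - g \<eta>) \<eta>"
      using assms by (intro has_delta_derivative_diff G(1) delta_int_antiderivative) auto
    moreover have "J \<inter> {a..t} \<subseteq> J \<inter> {a..sigma J t}" using sigma_ge[OF assms(1)] by auto
    ultimately have "has_delta_derivative J (J \<inter> {a..t}) (\<lambda>x. G x - delta_int a x g) (\<eta> - \<eta>) \<eta>"
      by (simp add: has_delta_derivative_subset)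
    then show "\<exists>l. \<bar>l\<bar> \<le> 0 \<and> has_delta_derivative J (J \<inter> {a..t}) (\<lambda>x. G x - delta_int a x g) l \<eta>" by auto
  qed (use assms a_in J_bounds in auto)
  then show ?thesis using G(2) by simp
qed

end

section \<open>Volterra kernels and their diagonal\<close>

text \<open>The constants \<open>L\<close> and \<open>M\<close> bound the kernel of the differentiated equation and the reciprocal of the
  diagonal; their product governs the rate of the weight that makes the fixed point problem
  contractive.\<close>
locale volterra_kernel = compact_time_scale +
  fixes K K1 :: "real \<Rightarrow> real \<Rightarrow> real" and L M :: real
  assumes K1_derivative: "delta1_derivative J a b K K1"
    and K_rd_Omega: "rd_continuous_Omega J a b K"
    and K1_rd_Omega: "rd_continuous_Omega J a b K1"
    and K1_bound: "\<And>t s. s \<in> J \<Longrightarrow> t \<in> J \<Longrightarrow> s \<le> t \<Longrightarrow> \<bar>K1 t s\<bar> \<le> L"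
    and diagonal_nonzero: "\<And>t. t \<in> kappa J \<Longrightarrow> K (sigma J t) t \<noteq> 0"
    and diagonal_bound: "\<And>t. t \<in> kappa J \<Longrightarrow> \<bar>inverse (K (sigma J t) t)\<bar> \<le> M"
begin

lemma J_Icc: "J \<inter> {a..b} = J"
  using J_subset by auto

lemma K_rd_snd: "t \<in> J \<Longrightarrow> rd (J \<inter> {a..t}) (K t)"
  and K1_rd_fst: "s \<in> J \<Longrightarrow> rd (J \<inter> {s..b}) (\<lambda>t. K1 t s)"
  and K1_rd_snd: "t \<in> J \<Longrightarrow> rd (J \<inter> {a..t}) (K1 t)"
  using K_rd_Omega K1_rd_Omega by (simp_all add: rd_continuous_Omega_def J_Icc)

lemma K_cell_integrable: assumes "t \<in> J" shows "cell_integrable t (K t)"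
  using J_bounds(2)[OF assms] closed_J by (intro cell_integrable_rd[OF K_rd_snd[OF assms]]) auto

lemma K1_cell_integrable: assumes "t \<in> J" shows "cell_integrable t (K1 t)"
  using J_bounds(2)[OF assms] closed_J by (intro cell_integrable_rd[OF K1_rd_snd[OF assms]]) auto

lemma K_derivative:
  "s \<in> J \<Longrightarrow> t \<in> kappa J \<Longrightarrow> s \<le> t \<Longrightarrow> has_delta_derivative J (J \<inter> {s..b}) (\<lambda>\<tau>. K \<tau> s) (K1 t s) t"
  using K1_derivative J_bounds(2)[of t] kappa_subset J_Icc unfolding delta1_derivative_def by auto

lemma L_nonneg: "0 \<le> L"
  using K1_bound[OF a_in a_in order_refl] by linarith

lemma K_lipschitz:
  assumes "\<eta> \<in> J" "s \<in> J" "t \<in> J" "\<eta> \<le> s" "\<eta> \<le> t"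
  shows "\<bar>K t \<eta> - K s \<eta>\<bar> \<le> L * \<bar>t - s\<bar>"
proof -
  have *: "\<bar>K t \<eta> - K s \<eta>\<bar> \<le> L * (t - s)" if "s \<in> J" "t \<in> J" "\<eta> \<le> s" "s \<le> t" for s t
  proof (rule mean_value_bound[OF that(1,2,4) L_nonneg])
    fix x assume x: "x \<in> kappa J" "s \<le> x" "x \<le> t"
    then have xJ: "x \<in> J" using kappa_subset by auto
    have "J \<inter> {s..t} \<subseteq> J \<inter> {\<eta>..b}" using that J_bounds(2)[OF that(2)] by auto
    then have "has_delta_derivative J (J \<inter> {s..t}) (\<lambda>\<tau>. K \<tau> \<eta>) (K1 x \<eta>) x"
      using K_derivative[OF assms(1) x(1)] x(2) that(3) by (auto intro: has_delta_derivative_subset)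
    moreover have "\<bar>K1 x \<eta>\<bar> \<le> L" using K1_bound[OF assms(1) xJ] x(2) that(3) by simp
    ultimately show "\<exists>l. \<bar>l\<bar> \<le> L \<and> has_delta_derivative J (J \<inter> {s..t}) (\<lambda>\<tau>. K \<tau> \<eta>) l x" by blast
  qed
  show ?thesis using *[of s t] *[of t s] assms by (cases "s \<le> t") (auto simp: abs_minus_commute)
qed

definition diag :: "real \<Rightarrow> real" where
  "diag t = K (sigma J t) t"

lemma K_near_diag:
  assumes "\<eta> \<in> J" "t \<in> J" "sigma J \<eta> \<le> t"
  shows "\<bar>K t \<eta> - diag \<eta>\<bar> \<le> L * (t - \<eta>)"
proof -
  have "\<bar>K t \<eta> - diag \<eta>\<bar> \<le> L * \<bar>t - sigma J \<eta>\<bar>"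
    unfolding diag_def using assms sigma_ge[OF assms(1)] sigma_in[OF assms(1)] by (intro K_lipschitz) auto
  also have "\<dots> \<le> L * (t - \<eta>)"
    using L_nonneg sigma_ge[OF assms(1)] assms(3) by (intro mult_left_mono) auto
  finally show ?thesis .
qed

text \<open>The kernel is not defined above the diagonal, so its continuity along the diagonal cannot be read off
  at a point \<open>(t, t)\<close>. To the right of a right-dense \<open>t\<close>, the diagonal is compared with the section
  \<open>K u\<close> for a single \<open>u\<close> slightly beyond \<open>t\<close>; that section is continuous at \<open>t\<close>, and the Lipschitz bound
  makes the comparison uniform. To the left, the section \<open>K t\<close> itself differs from the diagonal by
  \<open>O(t - s)\<close> and has a limit.\<close>
lemma diag_rd: "rd J diag"
  unfolding rd_continuous_on_def
proof (intro conjI ballI impI)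
  fix t assume t: "t \<in> J" and dense: "sigma J t = t"
  show "continuous (at t within J) diag"
    unfolding continuous_within_eps_delta
  proof (intro allI impI)
    fix e :: real assume e: "e > 0"
    \<comment> \<open>three comparisons, two of them costing \<open>L\<close> times a distance of at most \<open>2 * c\<close> and \<open>c\<close>, have to
      stay below \<open>e\<close> in total\<close>
    define c where "c = e / (4 * (L + 1))"
    have c: "c > 0" "L * c \<le> e / 4"
    proof -
      show "c > 0" using e L_nonneg by (simp add: c_def)
      then have "L * c \<le> (L + 1) * c" by (simp add: algebra_simps)
      also have "\<dots> = e / 4" using L_nonneg by (simp add: c_def field_simps)
      finally show "L * c \<le> e / 4" .
    qed
    \<comment> \<open>at the maximum of \<open>J\<close> there is no later section, but the section at \<open>b\<close> itself serves\<close>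
    have "\<exists>u\<in>J. \<exists>d>0. t \<le> u \<and> u \<le> t + c \<and> (\<forall>s\<in>J. \<bar>s - t\<bar> < d \<longrightarrow> sigma J s \<le> u)"
    proof (cases "t = b")
      case True
      then show ?thesis using c b_in sigma_bounds(2) by (intro bexI[of _ b] exI[of _ 1]) auto
    next
      case False
      then have "t < b" using J_bounds[OF t] by simp
      then obtain u where u: "u \<in> J" "t < u" "u < t + c" using right_dense_points[OF t _ dense c(1)] by blast
      have "sigma J s \<le> u" if "s \<in> J" "\<bar>s - t\<bar> < u - t" for s
        using that u by (intro sigma_le) auto
      then show ?thesis using u by (intro bexI[of _ u] exI[of _ "u - t"]) auto
    qed
    then obtain u d where u: "u \<in> J" "d > 0" "t \<le> u" "u \<le> t + c"
      "\<And>s. s \<in> J \<Longrightarrow> \<bar>s - t\<bar> < d \<Longrightarrow> sigma J s \<le> u" by blast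
    have "continuous (at t within (J \<inter> {a..u})) (K u)"
      using t u(3) J_bounds(1)[OF t] by (intro rd_right[OF K_rd_snd[OF u(1)] _ dense]) auto
    moreover have "e / 4 > 0" using e by simp
    ultimately obtain d1 where d1: "d1 > 0"
      "\<And>s. s \<in> J \<inter> {a..u} \<Longrightarrow> dist s t < d1 \<Longrightarrow> dist (K u s) (K u t) < e / 4"
      unfolding continuous_within_eps_delta by blast
    have "dist (diag s) (diag t) < e" if s: "s \<in> J" "dist s t < min d (min d1 c)" for s
    proof -
      have st: "\<bar>s - t\<bar> < d" "\<bar>s - t\<bar> < d1" "\<bar>s - t\<bar> < c" using s(2) by (auto simp: dist_real_def)
      have su: "sigma J s \<le> u" using u(5) s(1) st(1) .
      have "\<bar>K u s - K u t\<bar> < e / 4"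
        using d1(2)[of s] s(1) st(2) su sigma_ge[OF s(1)] J_bounds(1)[OF s(1)] by (auto simp: dist_real_def)
      moreover have "\<bar>K u t - diag t\<bar> \<le> e / 4"
      proof -
        have "\<bar>K u t - diag t\<bar> \<le> L * (u - t)" using K_near_diag[OF t u(1)] dense u(3) by simp
        also have "\<dots> \<le> L * c" using u(4) L_nonneg by (intro mult_left_mono) auto
        finally show ?thesis using c(2) by simp
      qed
      moreover have "\<bar>K u s - diag s\<bar> \<le> 2 * (e / 4)"
      proof -
        have "\<bar>K u s - diag s\<bar> \<le> L * (u - s)" using K_near_diag[OF s(1) u(1) su] .
        also have "\<dots> \<le> L * (2 * c)" using u(4) st(3) L_nonneg by (intro mult_left_mono) auto
        finally show ?thesis using c(2) by simp
      qed
      ultimately show ?thesis unfolding dist_real_def by linarith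
    qed
    then show "\<exists>d>0. \<forall>s\<in>J. dist s t < d \<longrightarrow> dist (diag s) (diag t) < e"
      using u(2) d1(1) c(1) by (intro exI[of _ "min d (min d1 c)"]) auto
  qed
next
  fix t assume t: "t \<in> J"
  let ?F = "at t within (J \<inter> {..<t})"
  have eq: "J \<inter> {a..t} \<inter> {..<t} = J \<inter> {..<t}" using J_bounds(1) by auto
  obtain l where l: "(K t \<longlongrightarrow> l) ?F"
    using rd_left[OF K_rd_snd[OF t], of t] t J_bounds(1)[OF t] unfolding eq by auto
  have "((\<lambda>s. diag s - K t s) \<longlongrightarrow> 0) ?F"
  proof (rule Lim_null_comparison)
    have "norm (diag s - K t s) \<le> L * (t - s)" if "s \<in> J \<inter> {..<t}" for s
      using K_near_diag[of s t] sigma_le[of t s] that t by (auto simp: abs_minus_commute)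
    then show "\<forall>\<^sub>F s in ?F. norm (diag s - K t s) \<le> L * (t - s)"
      by (auto simp: eventually_at intro!: exI[of _ 1])
    have "((\<lambda>s. L * (t - s)) \<longlongrightarrow> L * (t - t)) ?F" by (intro tendsto_intros)
    then show "((\<lambda>s. L * (t - s)) \<longlongrightarrow> 0) ?F" by simp
  qed
  from tendsto_add[OF this l] show "\<exists>l. (diag \<longlongrightarrow> l) ?F" by auto
qed

section \<open>The integral operator of the differentiated kernel\<close>

definition K1_op :: "(real \<Rightarrow> real) \<Rightarrow> real \<Rightarrow> real" where
  "K1_op h t = delta_int a t (\<lambda>\<eta>. K1 t \<eta> * h \<eta>)"

lemma K1_op_cell_integrable:
  assumes "cell_integrable b h" "t \<in> J"
  shows "cell_integrable t (\<lambda>\<eta>. K1 t \<eta> * h \<eta>)"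
  using assms J_bounds(2)[OF assms(2)]
  by (intro cell_integrable_mult K1_cell_integrable cell_integrable_mono[OF assms(1)])

lemma K1_op_diff:
  assumes "cell_integrable b g" "cell_integrable b h" "t \<in> J"
  shows "K1_op (\<lambda>x. g x - h x) t = K1_op g t - K1_op h t"
  unfolding K1_op_def right_diff_distrib
  using delta_int_diff[OF K1_op_cell_integrable[OF assms(1,3)] K1_op_cell_integrable[OF assms(2,3)] order_refl] .

lemma K1_op_converges:
  assumes h: "cell_integrable b h" and X: "\<And>i. X i \<in> J" "X \<longlonglongrightarrow> t"
    and v: "\<And>y. a \<le> y \<Longrightarrow> y < t \<Longrightarrow> (\<lambda>i. K1 (X i) (left_end y)) \<longlonglongrightarrow> v y"
  shows "(\<lambda>i. K1_op h (X i)) \<longlonglongrightarrow> (LINT y|lborel. indicator {a..<t} y * (v y * h (left_end y)))"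
proof -
  obtain B where B: "B \<ge> 0" "\<And>\<eta>. \<eta> \<in> J \<inter> {a..<b} \<Longrightarrow> \<bar>h \<eta>\<bar> \<le> B"
    using cell_integrable_bound[OF h] by blast
  show ?thesis
    unfolding K1_op_def delta_int_def
  proof (rule bounded_convergence_moving_end(2)[where b = b and C = "L * B"])
    show "(\<lambda>y. indicator {a..<X i} y * (K1 (X i) (left_end y) * h (left_end y))) \<in> borel_measurable borel" for i
      using cell_integrable_measurable[OF K1_op_cell_integrable[OF h X(1)]] .
    show "\<bar>K1 (X i) (left_end y) * h (left_end y)\<bar> \<le> L * B" if "a \<le> y" "y < X i" for i y
    proof -
      have "left_end y \<in> J \<inter> {a..<X i}" using left_end_in_cell[OF order_refl a_in that] .
      then show ?thesis
        unfolding abs_mult using J_bounds(2)[OF X(1)[of i]] L_nonneg X(1)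
        by (intro mult_mono K1_bound B(2)) auto
    qed
    show "X i \<le> b" for i using J_bounds(2) X(1) by blast
    show "(\<lambda>i. K1 (X i) (left_end y) * h (left_end y)) \<longlonglongrightarrow> v y * h (left_end y)" if "a \<le> y" "y < t" for y
      by (intro tendsto_mult_right v that)
  qed (rule X(2))
qed

text \<open>The section of a kernel at \<open>left_end y\<close> is defined only to the right of that point. A sequence tending
  to \<open>t > y\<close> eventually lies in its domain, which is all that pointwise convergence needs.\<close>
lemma eventually_in_section:
  assumes "\<And>i. X i \<in> J" "X \<longlonglongrightarrow> t" "a \<le> y" "y < t"
  shows "\<forall>\<^sub>F i in sequentially. X i \<in> J \<inter> {left_end y..b}"
  using order_tendstoD(1)[OF assms(2,4)]
proof eventually_elim
  case (elim i)
  then show ?case using left_end_le[OF assms(3)] assms(1)[of i] J_bounds(2)[of "X i"] by auto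
qed

text \<open>Regularity in \<open>t\<close> is inherited from the sections of \<open>K1\<close> by dominated convergence, whatever the
  regularity of \<open>h\<close>. Therefore a mere pointwise limit \<open>h\<close> of approximate solutions becomes rd-continuous
  as soon as it satisfies the equation of the second kind. The one-sided limit at \<open>t\<close> is the integral
  of the one-sided limits of the sections.\<close>
lemma K1_op_rd:
  assumes h: "cell_integrable b h"
  shows "rd J (K1_op h)"
  unfolding rd_continuous_on_def
proof (intro conjI ballI impI)
  fix t assume t: "t \<in> J" and dense: "sigma J t = t"
  show "continuous (at t within J) (K1_op h)"
  proof (rule continuous_within_sequentiallyI)
    fix X :: "nat \<Rightarrow> real" assume X: "X \<longlonglongrightarrow> t" "\<forall>n. X n \<in> J"
    have "(\<lambda>i. K1 (X i) (left_end y)) \<longlonglongrightarrow> K1 t (left_end y)" if y: "a \<le> y" "y < t" for y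
    proof (rule continuous_within_tendsto_compose[OF _ eventually_in_section X(1)])
      have "t \<in> J \<inter> {left_end y..b}" using t left_end_le[OF y(1)] y(2) J_bounds(2)[OF t] by auto
      then show "continuous (at t within (J \<inter> {left_end y..b})) (\<lambda>t. K1 t (left_end y))"
        by (rule rd_right[OF K1_rd_fst[OF left_end_in[OF y(1)]] _ dense])
    qed (use X y in auto)
    from K1_op_converges[OF h _ X(1) this] show "(\<lambda>n. K1_op h (X n)) \<longlonglongrightarrow> K1_op h t"
      using X(2) unfolding K1_op_def[of h t] delta_int_def by simp
  qed
next
  fix t assume t: "t \<in> J"
  have "\<exists>l. ((\<lambda>s. K1 s \<eta>) \<longlongrightarrow> l) (at t within (J \<inter> {\<eta>..b} \<inter> {..<t}))" if "\<eta> \<in> J" "\<eta> < t" for \<eta>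
    using rd_left[OF K1_rd_fst[OF that(1)], of t] t that J_bounds(2)[OF t] by auto
  then obtain l where l: "\<And>\<eta>. \<eta> \<in> J \<Longrightarrow> \<eta> < t \<Longrightarrow>
      ((\<lambda>s. K1 s \<eta>) \<longlongrightarrow> l \<eta>) (at t within (J \<inter> {\<eta>..b} \<inter> {..<t}))"
    by metis
  show "\<exists>l. (K1_op h \<longlongrightarrow> l) (at t within (J \<inter> {..<t}))"
  proof (rule exI, subst tendsto_at_iff_sequentially, intro allI impI)
    fix X :: "nat \<Rightarrow> real" assume X: "\<forall>i. X i \<in> J \<inter> {..<t} - {t}" "X \<longlonglongrightarrow> t"
    have "(\<lambda>i. K1 (X i) (left_end y)) \<longlonglongrightarrow> l (left_end y)" if y: "a \<le> y" "y < t" for y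
    proof (rule filterlim_compose[OF l])
      show "left_end y \<in> J" "left_end y < t" using left_end_in left_end_le[OF y(1)] y by auto
      have ev: "\<forall>\<^sub>F i in sequentially. X i \<in> J \<inter> {left_end y..b}"
        using X y by (intro eventually_in_section) auto
      show "filterlim X (at t within (J \<inter> {left_end y..b} \<inter> {..<t})) sequentially"
        unfolding filterlim_at
      proof
        show "\<forall>\<^sub>F i in sequentially. X i \<in> J \<inter> {left_end y..b} \<inter> {..<t} \<and> X i \<noteq> t"
          using ev by eventually_elim (use X(1) in auto)
      qed (rule X(2))
    qed
    from K1_op_converges[OF h _ X(2) this]
    show "(K1_op h \<circ> X) \<longlonglongrightarrow> (LINT y|lborel. indicator {a..<t} y * (l (left_end y) * h (left_end y)))"
      using X(1) by (simp add: o_def)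
  qed
qed

lemma cell_integrable_kappa: "rd (kappa J) h \<Longrightarrow> cell_integrable b h"
  using in_kappa by (intro cell_integrable_rd[OF _ closed_kappa kappa_subset]) auto

section \<open>Differentiating under the integral sign\<close>

text \<open>What is left of \<open>K\<close> after its diagonal is removed. The new kernel vanishes at \<open>(\<sigma> \<eta>, \<eta>)\<close>, so that the
  moving upper limit contributes nothing to the derivative.\<close>
definition remainder_op :: "(real \<Rightarrow> real) \<Rightarrow> real \<Rightarrow> real" where
  "remainder_op \<phi> t = delta_int a t (\<lambda>\<eta>. (K t \<eta> - diag \<eta>) * \<phi> \<eta>)"

lemma diag_cell_integrable: "cell_integrable b diag"
  using closed_J by (intro cell_integrable_rd[OF diag_rd]) auto

text \<open>The first summand is quadratically small (\<open>remainder_op_near_part\<close>), and the second one, divided by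
  \<open>t - s\<close>, is an integral of difference quotients of \<open>K\<close>.\<close>
lemma remainder_op_increment:
  assumes \<phi>: "cell_integrable b \<phi>" and "s \<in> J" "t \<in> J" "s \<le> t"
  shows "remainder_op \<phi> t - remainder_op \<phi> s = delta_int s t (\<lambda>\<eta>. (K t \<eta> - diag \<eta>) * \<phi> \<eta>) +
    delta_int a s (\<lambda>\<eta>. (K t \<eta> - K s \<eta>) * \<phi> \<eta>)"
proof -
  have di: "cell_integrable t (\<lambda>\<eta>. (K t \<eta> - diag \<eta>) * \<phi> \<eta>)" if "t \<in> J" for t
    using J_bounds(2)[OF that]
    by (intro cell_integrable_mult cell_integrable_diff K_cell_integrable that cell_integrable_mono[OF diag_cell_integrable]
        cell_integrable_mono[OF \<phi>])
  have as: "a \<le> s" using J_bounds(1)[OF assms(2)] .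
  have "remainder_op \<phi> t = delta_int a s (\<lambda>\<eta>. (K t \<eta> - diag \<eta>) * \<phi> \<eta>) + delta_int s t (\<lambda>\<eta>. (K t \<eta> - diag \<eta>) * \<phi> \<eta>)"
    unfolding remainder_op_def using delta_int_split[OF di[OF assms(3)] order_refl as assms(4)] .
  moreover have "delta_int a s (\<lambda>\<eta>. (K t \<eta> - diag \<eta>) * \<phi> \<eta>) - remainder_op \<phi> s =
      delta_int a s (\<lambda>\<eta>. (K t \<eta> - K s \<eta>) * \<phi> \<eta>)"
    unfolding remainder_op_def
    using delta_int_diff[OF cell_integrable_mono[OF di[OF assms(3)] assms(4)] di[OF assms(2)] order_refl]
    by (simp add: algebra_simps)
  ultimately show ?thesis by simp
qed

lemma remainder_op_near_part:
  assumes \<phi>: "cell_integrable b \<phi>" and B: "0 \<le> B" "\<And>\<eta>. \<eta> \<in> J \<inter> {a..<b} \<Longrightarrow> \<bar>\<phi> \<eta>\<bar> \<le> B"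
    and st: "s \<in> J" "t \<in> J" "s \<le> t"
  shows "\<bar>delta_int s t (\<lambda>\<eta>. (K t \<eta> - diag \<eta>) * \<phi> \<eta>)\<bar> \<le> L * (t - s) * B * (t - s)"
proof (rule delta_int_bound[OF _ st(1,3)])
  show "cell_integrable t (\<lambda>\<eta>. (K t \<eta> - diag \<eta>) * \<phi> \<eta>)"
    using J_bounds(2)[OF st(2)]
    by (intro cell_integrable_mult cell_integrable_diff K_cell_integrable st cell_integrable_mono[OF diag_cell_integrable]
        cell_integrable_mono[OF \<phi>])
  fix \<eta> assume \<eta>: "\<eta> \<in> J \<inter> {s..<t}"
  have "\<bar>K t \<eta> - diag \<eta>\<bar> \<le> L * (t - \<eta>)"
    using \<eta> st sigma_le[of t \<eta>] by (intro K_near_diag) auto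
  also have "\<dots> \<le> L * (t - s)" using \<eta> L_nonneg by (intro mult_left_mono) auto
  finally show "\<bar>(K t \<eta> - diag \<eta>) * \<phi> \<eta>\<bar> \<le> L * (t - s) * B"
    unfolding abs_mult using \<eta> st J_bounds(1)[OF st(1)] J_bounds(2)[OF st(2)] B L_nonneg
    by (intro mult_mono) auto
qed

lemma remainder_op_far_part_cell_integrable:
  assumes \<phi>: "cell_integrable b \<phi>" and st: "s \<in> J" "t \<in> J" "s \<le> t"
  shows "cell_integrable s (\<lambda>\<eta>. (K t \<eta> - K s \<eta>) * \<phi> \<eta>)"
  using J_bounds(2)[OF st(1)] st(3)
  by (intro cell_integrable_mult cell_integrable_diff K_cell_integrable st(1) cell_integrable_mono[OF K_cell_integrable[OF st(2)]]
        cell_integrable_mono[OF \<phi>])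

lemma remainder_op_lipschitz:
  assumes \<phi>: "cell_integrable b \<phi>"
  shows "\<exists>C. \<forall>s\<in>J. \<forall>t\<in>J. \<bar>remainder_op \<phi> t - remainder_op \<phi> s\<bar> \<le> C * \<bar>t - s\<bar>"
proof -
  obtain B where B: "B \<ge> 0" "\<And>\<eta>. \<eta> \<in> J \<inter> {a..<b} \<Longrightarrow> \<bar>\<phi> \<eta>\<bar> \<le> B"
    using cell_integrable_bound[OF \<phi>] by blast
  have *: "\<bar>remainder_op \<phi> t - remainder_op \<phi> s\<bar> \<le> (2 * L * B * (b - a)) * (t - s)" if st: "s \<in> J" "t \<in> J" "s \<le> t" for s t
  proof -
    have "\<bar>delta_int a s (\<lambda>\<eta>. (K t \<eta> - K s \<eta>) * \<phi> \<eta>)\<bar> \<le> L * (t - s) * B * (s - a)"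
    proof (rule delta_int_bound[OF remainder_op_far_part_cell_integrable[OF \<phi> st] a_in])
      show "a \<le> s" using J_bounds st by auto
      fix \<eta> assume \<eta>: "\<eta> \<in> J \<inter> {a..<s}"
      have "\<bar>K t \<eta> - K s \<eta>\<bar> \<le> L * (t - s)" using K_lipschitz[of \<eta> s t] \<eta> st by auto
      then show "\<bar>(K t \<eta> - K s \<eta>) * \<phi> \<eta>\<bar> \<le> L * (t - s) * B"
        unfolding abs_mult using \<eta> J_bounds(2)[OF st(1)] st(3) B L_nonneg
        by (intro mult_mono) auto
    qed
    moreover have "L * (t - s) * B * (s - a) \<le> L * (t - s) * B * (b - a)"
      using J_bounds[OF st(1)] L_nonneg B(1) st(3) by (intro mult_left_mono) auto
    moreover have "L * (t - s) * B * (t - s) \<le> L * (t - s) * B * (b - a)"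
      using J_bounds[OF st(1)] J_bounds[OF st(2)] L_nonneg B(1) st(3) by (intro mult_left_mono) auto
    moreover have "(2 * L * B * (b - a)) * (t - s) = L * (t - s) * B * (b - a) + L * (t - s) * B * (b - a)"
      by (simp add: algebra_simps)
    ultimately show ?thesis
      using remainder_op_near_part[OF \<phi> B st] unfolding remainder_op_increment[OF \<phi> st] by linarith
  qed
  show ?thesis
  proof (intro exI ballI)
    fix s t assume "s \<in> J" "t \<in> J"
    then show "\<bar>remainder_op \<phi> t - remainder_op \<phi> s\<bar> \<le> (2 * L * B * (b - a)) * \<bar>t - s\<bar>"
      using *[of s t] *[of t s] by (cases "s \<le> t") (auto simp: abs_minus_commute)
  qed
qed

text \<open>The Leibniz rule. At right-scattered points the contribution of the gap is zero and the difference
  quotient of \<open>K\<close> equals \<open>K1\<close>. At right-dense points, sequences on both sides are treated at once by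
  ordering \<open>X i\<close> and \<open>t\<close>; the quotients of \<open>K\<close> are bounded by \<open>L\<close> and converge pointwise, so dominated
  convergence applies.\<close>
lemma remainder_op_derivative:
  assumes \<phi>: "cell_integrable b \<phi>" and t: "t \<in> kappa J"
  shows "has_delta_derivative J J (remainder_op \<phi>) (K1_op \<phi> t) t"
proof (cases "sigma J t = t")
  case False
  have tJ: "t \<in> J" using t kappa_subset by auto
  have ts: "t < sigma J t" using False sigma_ge[OF tJ] by simp
  obtain C where "\<And>s t. s \<in> J \<Longrightarrow> t \<in> J \<Longrightarrow> \<bar>remainder_op \<phi> t - remainder_op \<phi> s\<bar> \<le> C * \<bar>t - s\<bar>" using remainder_op_lipschitz[OF \<phi>] by blast
  then have "continuous (at t within J) (remainder_op \<phi>)" using tJ by (intro continuous_if_lipschitz) auto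
  moreover have "remainder_op \<phi> (sigma J t) - remainder_op \<phi> t = K1_op \<phi> t * (sigma J t - t)"
  proof -
    have "delta_int a t (\<lambda>\<eta>. (K (sigma J t) \<eta> - K t \<eta>) * \<phi> \<eta>) =
        delta_int a t (\<lambda>\<eta>. (sigma J t - t) * (K1 t \<eta> * \<phi> \<eta>))"
    proof (rule delta_int_cong[OF a_in])
      fix \<eta> assume \<eta>: "\<eta> \<in> J \<inter> {a..<t}"
      have "K (sigma J t) \<eta> - K t \<eta> = K1 t \<eta> * (sigma J t - t)"
        using K_derivative[of \<eta> t] has_delta_derivative_right_scattered[OF ts, of "J \<inter> {\<eta>..b}"]
          \<eta> t tJ J_bounds(2)[OF tJ] by auto
      then show "(K (sigma J t) \<eta> - K t \<eta>) * \<phi> \<eta> = (sigma J t - t) * (K1 t \<eta> * \<phi> \<eta>)" by simp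
    qed
    then show ?thesis
      using remainder_op_increment[OF \<phi> tJ sigma_in[OF tJ]] ts delta_int_cell[OF tJ]
      by (simp add: delta_int_cmult K1_op_def diag_def)
  qed
  ultimately show ?thesis using has_delta_derivative_right_scattered[OF ts tJ] by blast
next
  case dense: True
  have tJ: "t \<in> J" using t kappa_subset by auto
  obtain B where B: "B \<ge> 0" "\<And>\<eta>. \<eta> \<in> J \<inter> {a..<b} \<Longrightarrow> \<bar>\<phi> \<eta>\<bar> \<le> B"
    using cell_integrable_bound[OF \<phi>] by blast
  show ?thesis
    unfolding has_delta_derivative_right_dense[OF dense] has_field_derivative_iff tendsto_at_iff_sequentially
  proof (intro allI impI)
    fix X :: "nat \<Rightarrow> real" assume X: "\<forall>i. X i \<in> J - {t}" "X \<longlonglongrightarrow> t"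
    define lo hi where "lo i = min (X i) t" and "hi i = max (X i) t" for i
    have J: "lo i \<in> J" "hi i \<in> J" and lt: "lo i < hi i" and lot: "lo i \<le> t"
      and len: "hi i - lo i = \<bar>X i - t\<bar>" for i
      using X(1)[rule_format, of i] tJ by (auto simp: lo_def hi_def min_def max_def)
    have quot: "(g (X i) - g t) / (X i - t) = (g (hi i) - g (lo i)) / (hi i - lo i)"
      for g :: "real \<Rightarrow> real" and i
      by (cases "X i \<le> t") (simp_all add: lo_def hi_def min_def max_def, metis minus_diff_eq minus_divide_divide)
    \<comment> \<open>\<open>A\<close> is the vanishing contribution of the moving end point, \<open>D\<close> the integral of the difference
      quotients\<close>
    define A where "A i = delta_int (lo i) (hi i) (\<lambda>\<eta>. (K (hi i) \<eta> - diag \<eta>) * \<phi> \<eta>) / (hi i - lo i)" for i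
    define D where "D i = delta_int a (lo i) (\<lambda>\<eta>. (K (hi i) \<eta> - K (lo i) \<eta>) / (hi i - lo i) * \<phi> \<eta>)" for i
    have split: "(remainder_op \<phi> (X i) - remainder_op \<phi> t) / (X i - t) = A i + D i" for i
    proof -
      have "D i = delta_int a (lo i) (\<lambda>\<eta>. inverse (hi i - lo i) * ((K (hi i) \<eta> - K (lo i) \<eta>) * \<phi> \<eta>))"
        unfolding D_def by (simp add: divide_inverse ac_simps)
      then have "D i = delta_int a (lo i) (\<lambda>\<eta>. (K (hi i) \<eta> - K (lo i) \<eta>) * \<phi> \<eta>) / (hi i - lo i)"
        unfolding delta_int_cmult by (simp add: divide_inverse ac_simps)
      then show ?thesis
        unfolding quot remainder_op_increment[OF \<phi> J less_imp_le[OF lt]] A_def by (simp add: add_divide_distrib)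
    qed
    have "A \<longlonglongrightarrow> 0"
    proof (rule Lim_null_comparison)
      have "norm (A i) \<le> L * B * \<bar>X i - t\<bar>" for i
      proof -
        have "\<bar>A i\<bar> \<le> L * (hi i - lo i) * B"
          unfolding A_def abs_divide using remainder_op_near_part[OF \<phi> B J less_imp_le[OF lt], of i] lt[of i]
          by (simp add: pos_divide_le_eq)
        also have "\<dots> = L * B * (hi i - lo i)" by simp
        finally show ?thesis using len by simp
      qed
      then show "\<forall>\<^sub>F i in sequentially. norm (A i) \<le> L * B * \<bar>X i - t\<bar>" by simp
      have "(\<lambda>i. L * B * \<bar>X i - t\<bar>) \<longlonglongrightarrow> L * B * \<bar>t - t\<bar>" by (intro tendsto_intros X(2))
      then show "(\<lambda>i. L * B * \<bar>X i - t\<bar>) \<longlonglongrightarrow> 0" by simp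
    qed
    moreover have "D \<longlonglongrightarrow> K1_op \<phi> t"
      unfolding D_def K1_op_def delta_int_def
    proof (rule bounded_convergence_moving_end(2)[where b = b and C = "L * B"])
      fix i
      have "cell_integrable (lo i) (\<lambda>\<eta>. inverse (hi i - lo i) * ((K (hi i) \<eta> - K (lo i) \<eta>) * \<phi> \<eta>))"
        by (intro cell_integrable_mult cell_integrable_const remainder_op_far_part_cell_integrable[OF \<phi> J less_imp_le[OF lt]])
      then have "cell_integrable (lo i) (\<lambda>\<eta>. (K (hi i) \<eta> - K (lo i) \<eta>) / (hi i - lo i) * \<phi> \<eta>)"
        by (simp add: divide_inverse ac_simps)
      then show "(\<lambda>y. indicator {a..<lo i} y * ((K (hi i) (left_end y) - K (lo i) (left_end y)) / (hi i - lo i) * \<phi> (left_end y)))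
          \<in> borel_measurable borel"
        by (rule cell_integrable_measurable)
      show "lo i \<le> b" using J_bounds(2) J by blast
      fix y assume y: "a \<le> y" "y < lo i"
      have \<eta>: "left_end y \<in> J \<inter> {a..<lo i}" using left_end_in_cell[OF order_refl a_in y] .
      have "\<bar>K (hi i) (left_end y) - K (lo i) (left_end y)\<bar> \<le> L * (hi i - lo i)"
        using K_lipschitz[of "left_end y" "lo i" "hi i"] \<eta> J[of i] lt[of i] by auto
      then have "\<bar>(K (hi i) (left_end y) - K (lo i) (left_end y)) / (hi i - lo i)\<bar> \<le> L"
        using lt[of i] by (simp add: abs_divide pos_divide_le_eq)
      then show "\<bar>(K (hi i) (left_end y) - K (lo i) (left_end y)) / (hi i - lo i) * \<phi> (left_end y)\<bar> \<le> L * B"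
        unfolding abs_mult using \<eta> J_bounds(2)[OF J(1)[of i]] B L_nonneg by (intro mult_mono) auto
    next
      have "(\<lambda>i. min (X i) t) \<longlonglongrightarrow> min t t" by (intro tendsto_min X(2) tendsto_const)
      then show "lo \<longlonglongrightarrow> t" by (simp add: lo_def[abs_def])
    next
      fix y assume y: "a \<le> y" "y < t"
      have "t \<in> kappa J" "left_end y \<le> t" using t left_end_le[OF y(1)] y(2) by auto
      from K_derivative[OF left_end_in[OF y(1)] this]
      have "((\<lambda>s. (K s (left_end y) - K t (left_end y)) / (s - t)) \<longlongrightarrow> K1 t (left_end y)) (at t within (J \<inter> {left_end y..b}))"
        unfolding has_delta_derivative_right_dense[OF dense] has_field_derivative_iff .
      moreover have "filterlim X (at t within (J \<inter> {left_end y..b})) sequentially"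
        unfolding filterlim_at
      proof
        have "\<forall>\<^sub>F i in sequentially. X i \<in> J \<inter> {left_end y..b}"
          using X y by (intro eventually_in_section) auto
        then show "\<forall>\<^sub>F i in sequentially. X i \<in> J \<inter> {left_end y..b} \<and> X i \<noteq> t"
          by eventually_elim (use X(1) in auto)
      qed (rule X(2))
      ultimately have "(\<lambda>i. (K (X i) (left_end y) - K t (left_end y)) / (X i - t)) \<longlonglongrightarrow> K1 t (left_end y)"
        by (rule filterlim_compose)
      then have "(\<lambda>i. (K (hi i) (left_end y) - K (lo i) (left_end y)) / (hi i - lo i)) \<longlonglongrightarrow> K1 t (left_end y)"
        using quot[of "\<lambda>s. K s (left_end y)"] by simp
      then show "(\<lambda>i. (K (hi i) (left_end y) - K (lo i) (left_end y)) / (hi i - lo i) * \<phi> (left_end y))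
          \<longlonglongrightarrow> K1 t (left_end y) * \<phi> (left_end y)"
        by (rule tendsto_mult_right)
    qed
    ultimately have "(\<lambda>i. A i + D i) \<longlonglongrightarrow> 0 + K1_op \<phi> t" by (rule tendsto_add)
    then show "((\<lambda>y. (remainder_op \<phi> y - remainder_op \<phi> t) / (y - t)) \<circ> X) \<longlonglongrightarrow> K1_op \<phi> t"
      by (simp add: o_def split)
  qed
qed

section \<open>Reduction to an equation of the second kind\<close>

definition K_op :: "(real \<Rightarrow> real) \<Rightarrow> real \<Rightarrow> real" where
  "K_op \<phi> t = delta_int a t (\<lambda>\<eta>. K t \<eta> * \<phi> \<eta>)"

lemma K_op_derivative:
  assumes "rd (kappa J) \<phi>" "t \<in> kappa J"
  shows "has_delta_derivative J J (K_op \<phi>) (diag t * \<phi> t + K1_op \<phi> t) t"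
proof -
  let ?P = "\<lambda>x. delta_int a x (\<lambda>\<eta>. diag \<eta> * \<phi> \<eta>)"
  have di: "cell_integrable b \<phi>" using cell_integrable_kappa[OF assms(1)] .
  have kb: "kappa J \<inter> {a..b} = kappa J" using kappa_subset J_subset by auto
  have "rd (kappa J \<inter> {a..b}) (\<lambda>\<eta>. diag \<eta> * \<phi> \<eta>)"
    unfolding kb by (intro rd_mult rd_subset[OF diag_rd] assms(1) kappa_subset)
  from delta_int_antiderivative[OF b_in this, of t]
  have P: "has_delta_derivative J J ?P (diag t * \<phi> t) t"
    using assms(2) by (simp add: kb J_Icc)
  have eq: "K_op \<phi> x = ?P x + remainder_op \<phi> x" if "x \<in> J" for x
  proof -
    have "remainder_op \<phi> x = K_op \<phi> x - ?P x"
      unfolding remainder_op_def K_op_def left_diff_distrib using J_bounds(2)[OF that]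
      by (intro delta_int_diff cell_integrable_mult K_cell_integrable that cell_integrable_mono[OF di]
          cell_integrable_mono[OF diag_cell_integrable]) auto
    then show ?thesis by simp
  qed
  have "has_delta_derivative J J (\<lambda>x. ?P x + remainder_op \<phi> x) (diag t * \<phi> t + K1_op \<phi> t) t"
    by (intro has_delta_derivative_add P remainder_op_derivative di assms(2))
  moreover have "sigma J t \<in> J" using assms(2) kappa_subset sigma_in by auto
  ultimately show ?thesis unfolding has_delta_derivative_def by (simp add: eq)
qed

lemma second_kind_iff:
  assumes \<phi>: "rd (kappa J) \<phi>" and "f a = 0"
    and f': "\<And>t. t \<in> kappa J \<Longrightarrow> has_delta_derivative J J f (f' t) t"
  shows "(\<forall>t\<in>J. f t = K_op \<phi> t) \<longleftrightarrow> (\<forall>t\<in>kappa J. diag t * \<phi> t + K1_op \<phi> t = f' t)"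
proof
  assume eq: "\<forall>t\<in>J. f t = K_op \<phi> t"
  show "\<forall>t\<in>kappa J. diag t * \<phi> t + K1_op \<phi> t = f' t"
  proof
    fix t assume t: "t \<in> kappa J"
    then have "sigma J t \<in> J" using kappa_subset sigma_in by auto
    then have "has_delta_derivative J J f (diag t * \<phi> t + K1_op \<phi> t) t"
      using K_op_derivative[OF \<phi> t] eq unfolding has_delta_derivative_def by simp
    then show "diag t * \<phi> t + K1_op \<phi> t = f' t"
      using has_delta_derivative_unique f'[OF t] t by blast
  qed
next
  assume eq: "\<forall>t\<in>kappa J. diag t * \<phi> t + K1_op \<phi> t = f' t"
  show "\<forall>t\<in>J. f t = K_op \<phi> t"
  proof
    fix t assume t: "t \<in> J"
    have "\<bar>(f t - K_op \<phi> t) - (f a - K_op \<phi> a)\<bar> \<le> 0 * (t - a)"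
    proof (rule mean_value_bound[OF a_in t J_bounds(1)[OF t] order_refl])
      fix x assume x: "x \<in> kappa J"
      have "has_delta_derivative J J (\<lambda>x. f x - K_op \<phi> x) (f' x - (diag x * \<phi> x + K1_op \<phi> x)) x"
        by (intro has_delta_derivative_diff f' K_op_derivative \<phi> x)
      then have "has_delta_derivative J J (\<lambda>x. f x - K_op \<phi> x) 0 x" using eq x by simp
      then have "has_delta_derivative J (J \<inter> {a..t}) (\<lambda>x. f x - K_op \<phi> x) 0 x"
        by (rule has_delta_derivative_subset) simp
      then show "\<exists>l. \<bar>l\<bar> \<le> 0 \<and> has_delta_derivative J (J \<inter> {a..t}) (\<lambda>x. f x - K_op \<phi> x) l x" by auto
    qed
    then show "f t = K_op \<phi> t" using assms(2) by (simp add: K_op_def)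
  qed
qed

lemma solution_iff:
  "volterra1_solution J a b K f \<phi> \<longleftrightarrow> rd (kappa J) \<phi> \<and> (\<forall>t\<in>J. f t = K_op \<phi> t)"
proof -
  have kb: "kappa J \<inter> {a..b} = kappa J" using kappa_subset J_subset by auto
  have "has_delta_integral J (\<lambda>\<eta>. K t \<eta> * \<phi> \<eta>) a t (f t) \<longleftrightarrow> f t = K_op \<phi> t"
    if "rd (kappa J) \<phi>" and t: "t \<in> J" for t
  proof -
    have "rd (kappa J \<inter> {a..t}) (\<lambda>\<eta>. K t \<eta> * \<phi> \<eta>)"
      using kappa_subset by (intro rd_mult rd_subset[OF K_rd_snd[OF t]] rd_subset[OF that(1)]) auto
    then show ?thesis
      unfolding K_op_def using has_delta_integral_delta_int[OF t] has_delta_integral_unique[OF t] by metis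
  qed
  then show ?thesis unfolding volterra1_solution_def kb J_Icc by blast
qed

section \<open>Solving the equation of the second kind\<close>

definition second_kind_op :: "(real \<Rightarrow> real) \<Rightarrow> real \<Rightarrow> real" where
  "second_kind_op h t = - inverse (diag t) * K1_op h t"

text \<open>Integration of \<open>exp (rate * (\<eta> - a))\<close> gains a factor \<open>1 / rate\<close>. This value makes the gain outweigh
  twice the bound \<open>L * M\<close> of the kernel; the summand \<open>1\<close> keeps it positive when that bound is zero.\<close>
definition rate :: real where "rate = 2 * L * M + 1"

definition weight :: "real \<Rightarrow> real" where "weight t = exp (rate * (t - a))"

lemma M_nonneg: "0 \<le> M"
  using diagonal_bound[OF in_kappa[OF a_in a_less_b]] by linarith

lemma rate_pos: "0 < rate"
  using L_nonneg M_nonneg by (simp add: rate_def add_nonneg_pos)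

lemma weight_pos: "0 < weight t" and weight_ge_1: "a \<le> t \<Longrightarrow> 1 \<le> weight t"
  using rate_pos by (simp_all add: weight_def)

lemma weight_mono: "s \<le> t \<Longrightarrow> weight s \<le> weight t"
  using rate_pos by (simp add: weight_def)

text \<open>The retraction moves points to the left, where the weight is smaller, so the integral over the time
  scale is dominated by the ordinary integral of the weight.\<close>
lemma K1_op_bound:
  assumes "cell_integrable b h" "t \<in> J" "0 \<le> A" "\<And>\<eta>. \<eta> \<in> J \<inter> {a..<t} \<Longrightarrow> \<bar>h \<eta>\<bar> \<le> A * weight \<eta>"
  shows "\<bar>K1_op h t\<bar> \<le> L * A * weight t / rate"
proof -
  have at: "a \<le> t" using J_bounds(1)[OF assms(2)] .
  \<comment> \<open>antiderivative of the majorant\<close>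
  let ?F = "\<lambda>y. L * A * weight y / rate"
  have deriv: "(?F has_vector_derivative L * A * weight y) (at y within {a..t})" for y
    unfolding weight_def has_real_derivative_iff_has_vector_derivative[symmetric]
    using rate_pos by (auto intro!: derivative_eq_intros)
  have cont: "continuous_on {a..t} (\<lambda>y. L * A * weight y)"
    unfolding weight_def by (intro continuous_intros)
  have int: "integrable lborel (\<lambda>y. indicator {a..t} y *\<^sub>R (L * A * weight y))"
    using borel_integrable_atLeastAtMost'[OF cont] by (simp add: set_integrable_def)
  have "\<bar>K1_op h t\<bar> \<le> (LINT y|lborel. indicator {a..t} y *\<^sub>R (L * A * weight y))"
    unfolding K1_op_def delta_int_def
  proof (rule integral_abs_bound_integral[OF _ int])
    show "integrable lborel (\<lambda>y. indicator {a..<t} y * (K1 t (left_end y) * h (left_end y)))"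
      using integrable_step[OF K1_op_cell_integrable[OF assms(1,2)]] by simp
    fix y
    show "\<bar>indicator {a..<t} y * (K1 t (left_end y) * h (left_end y))\<bar> \<le> indicator {a..t} y *\<^sub>R (L * A * weight y)"
    proof (cases "a \<le> y \<and> y < t")
      case True
      then have \<eta>: "left_end y \<in> J \<inter> {a..<t}" using left_end_in_cell[OF order_refl a_in] by blast
      have "\<bar>K1 t (left_end y) * h (left_end y)\<bar> \<le> L * (A * weight (left_end y))"
        unfolding abs_mult using \<eta> assms(2) L_nonneg by (intro mult_mono K1_bound assms(4)) auto
      also have "\<dots> \<le> L * (A * weight y)"
        using L_nonneg assms(3) True left_end_le by (intro mult_left_mono weight_mono) auto
      finally show ?thesis using True by simp
    next
      case False
      then have "indicator {a..<t} y = (0::real)" by auto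
      then show ?thesis using L_nonneg assms(3) weight_pos[of y] by (simp add: less_imp_le)
    qed
  qed
  also have "\<dots> = ?F t - ?F a"
    by (rule integral_FTC_atLeastAtMost[OF at deriv cont])
  also have "\<dots> \<le> ?F t"
    using L_nonneg assms(3) rate_pos weight_pos[of a] by simp
  finally show ?thesis .
qed

lemma second_kind_op_bound:
  assumes "cell_integrable b h" "t \<in> kappa J" "0 \<le> A" "\<And>\<eta>. \<eta> \<in> kappa J \<Longrightarrow> \<bar>h \<eta>\<bar> \<le> A * weight \<eta>"
  shows "\<bar>second_kind_op h t\<bar> \<le> A / 2 * weight t"
proof -
  have tJ: "t \<in> J" using assms(2) kappa_subset by auto
  have "\<bar>K1_op h t\<bar> \<le> L * A * weight t / rate"
    using J_bounds(2)[OF tJ] by (intro K1_op_bound assms(1,3,4) tJ in_kappa) auto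
  then have "\<bar>second_kind_op h t\<bar> \<le> M * (L * A * weight t / rate)"
    unfolding second_kind_op_def abs_mult abs_minus_cancel
    using diagonal_bound[OF assms(2)] M_nonneg by (intro mult_mono) (auto simp: diag_def)
  also have "\<dots> = (L * M / rate) * (A * weight t)" by simp
  also have "\<dots> \<le> 1 / 2 * (A * weight t)"
  proof (rule mult_right_mono)
    show "L * M / rate \<le> 1 / 2" using rate_pos by (simp add: divide_simps rate_def)
    show "0 \<le> A * weight t" using assms(3) weight_pos[of t] by simp
  qed
  finally show ?thesis by simp
qed

lemma inverse_diag_rd: "rd (kappa J) (\<lambda>t. inverse (diag t))"
proof (rule rd_inverse[OF rd_subset[OF diag_rd kappa_subset]])
  show "1 / (M + 1) > 0" using M_nonneg by simp
  fix t assume t: "t \<in> kappa J"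
  have "diag t \<noteq> 0" using diagonal_nonzero[OF t] by (simp add: diag_def)
  moreover have "inverse \<bar>diag t\<bar> \<le> M + 1"
    using diagonal_bound[OF t] by (simp add: diag_def)
  ultimately show "1 / (M + 1) \<le> \<bar>diag t\<bar>"
    using M_nonneg by (simp add: field_simps)
qed

lemma second_kind_op_rd: "cell_integrable b h \<Longrightarrow> rd (kappa J) (second_kind_op h)"
  unfolding second_kind_op_def[abs_def]
  using rd_mult[OF rd_mult[OF rd_const[of _ "-1"] inverse_diag_rd] rd_subset[OF K1_op_rd kappa_subset]]
  by simp

lemma second_kind_op_diff:
  "cell_integrable b g \<Longrightarrow> cell_integrable b h \<Longrightarrow> t \<in> kappa J \<Longrightarrow> second_kind_op (\<lambda>x. g x - h x) t = second_kind_op g t - second_kind_op h t"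
  using K1_op_diff[of g h t] kappa_subset by (simp add: second_kind_op_def right_diff_distrib subsetD)

text \<open>The difference of two solutions is a bounded fixed point of a linear operator that halves weighted
  bounds.\<close>
lemma second_kind_unique:
  assumes g: "rd (kappa J) g" "\<And>t. t \<in> kappa J \<Longrightarrow> g t = F t + second_kind_op g t"
    and h: "rd (kappa J) h" "\<And>t. t \<in> kappa J \<Longrightarrow> h t = F t + second_kind_op h t"
    and t: "t \<in> kappa J"
  shows "g t = h t"
proof -
  let ?d = "\<lambda>x. g x - h x"
  have d: "rd (kappa J) ?d" using rd_diff[OF g(1) h(1)] .
  have step: "?d t = second_kind_op ?d t" if "t \<in> kappa J" for t
    using second_kind_op_diff[OF cell_integrable_kappa[OF g(1)] cell_integrable_kappa[OF h(1)] that] g(2)[OF that] h(2)[OF that]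
    by simp
  obtain B where B: "\<And>t. t \<in> kappa J \<Longrightarrow> \<bar>?d t\<bar> \<le> B"
    using rd_bounded[OF d closed_kappa kappa_subset] by blast
  have B0: "0 \<le> B" using B[OF t] by linarith
  have bound: "\<forall>t\<in>kappa J. \<bar>?d t\<bar> \<le> B * (1 / 2) ^ n * weight t" for n
  proof (induction n)
    case 0
    show ?case
    proof
      fix t assume t: "t \<in> kappa J"
      have "B * 1 \<le> B * weight t"
        using t kappa_subset J_bounds(1) B0 by (intro mult_left_mono weight_ge_1) auto
      then show "\<bar>?d t\<bar> \<le> B * (1 / 2) ^ 0 * weight t" using B[OF t] by simp
    qed
  next
    case (Suc n)
    show ?case
    proof
      fix t assume t: "t \<in> kappa J"
      have "\<bar>second_kind_op ?d t\<bar> \<le> B * (1 / 2) ^ n / 2 * weight t"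
        using Suc B0 by (intro second_kind_op_bound cell_integrable_kappa[OF d] t) auto
      then show "\<bar>?d t\<bar> \<le> B * (1 / 2) ^ Suc n * weight t" using step[OF t] by simp
    qed
  qed
  have "(\<lambda>n. B * (1 / 2) ^ n * weight t) \<longlonglongrightarrow> B * 0 * weight t"
    by (intro tendsto_intros LIMSEQ_power_zero) simp
  then have "\<bar>?d t\<bar> \<le> 0"
    using bound t by (intro tendsto_lowerbound[where f = "\<lambda>n. B * (1 / 2) ^ n * weight t"]) auto
  then show ?thesis by simp
qed

text \<open>The Picard iterates from \<open>0\<close> differ by geometrically decreasing amounts and stay in a fixed weighted
  ball. Their pointwise limit is cell-integrable, and dominated convergence shows that it satisfies the
  equation; rd-continuity then follows from the equation itself.\<close>
lemma second_kind_exists: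
  assumes F: "rd (kappa J) F"
  shows "\<exists>g. rd (kappa J) g \<and> (\<forall>t\<in>kappa J. g t = F t + second_kind_op g t)"
proof -
  obtain A where A: "\<And>t. t \<in> kappa J \<Longrightarrow> \<bar>F t\<bar> \<le> A"
    using rd_bounded[OF F closed_kappa kappa_subset] by blast
  have A0: "0 \<le> A" using A[OF in_kappa[OF a_in a_less_b]] by linarith
  have AF: "\<bar>F t\<bar> \<le> A * weight t" if "t \<in> kappa J" for t
  proof -
    have "A * 1 \<le> A * weight t"
      using that kappa_subset J_bounds(1) A0 by (intro mult_left_mono weight_ge_1) auto
    then show ?thesis using A[OF that] by simp
  qed
  \<comment> \<open>the Picard iterates\<close>
  define S where "S = rec_nat (\<lambda>t. 0) (\<lambda>_ s t. F t + second_kind_op s t)"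
  have S_0: "S 0 = (\<lambda>t. 0)" and S_Suc: "S (Suc n) = (\<lambda>t. F t + second_kind_op (S n) t)" for n
    by (simp_all add: S_def)
  have S_rd: "rd (kappa J) (S n)" for n
  proof (induction n)
    case 0
    show ?case unfolding S_0 by (rule rd_const)
  next
    case (Suc n)
    have "rd (kappa J) (\<lambda>t. F t - (- 1) * second_kind_op (S n) t)"
      by (intro rd_diff rd_mult rd_const F second_kind_op_rd cell_integrable_kappa[OF Suc])
    then show ?case unfolding S_Suc by simp
  qed
  note S_di = cell_integrable_kappa[OF S_rd]
  have S_bound: "\<forall>t\<in>kappa J. \<bar>S n t\<bar> \<le> 2 * A * weight t" for n
  proof (induction n)
    case 0
    show ?case using A0 weight_pos by (simp add: S_0 less_imp_le)
  next
    case (Suc n)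
    show ?case
    proof
      fix t assume t: "t \<in> kappa J"
      have "\<bar>second_kind_op (S n) t\<bar> \<le> 2 * A / 2 * weight t"
        using Suc A0 by (intro second_kind_op_bound S_di t) auto
      then show "\<bar>S (Suc n) t\<bar> \<le> 2 * A * weight t" using AF[OF t] unfolding S_Suc by linarith
    qed
  qed
  have S_step: "\<forall>t\<in>kappa J. \<bar>S (Suc n) t - S n t\<bar> \<le> A * (1 / 2) ^ n * weight t" for n
  proof (induction n)
    case 0
    have "K1_op (\<lambda>t. 0) t = 0" for t by (simp add: K1_op_def delta_int_def)
    then show ?case using AF by (simp add: S_Suc S_0 second_kind_op_def)
  next
    case (Suc n)
    show ?case
    proof
      fix t assume t: "t \<in> kappa J"
      have "S (Suc (Suc n)) t - S (Suc n) t = second_kind_op (\<lambda>t. S (Suc n) t - S n t) t"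
        unfolding second_kind_op_diff[OF S_di S_di t] by (simp add: S_Suc)
      also have "\<bar>\<dots>\<bar> \<le> A * (1 / 2) ^ n / 2 * weight t"
        using Suc A0 by (intro second_kind_op_bound cell_integrable_diff S_di t) auto
      finally show "\<bar>S (Suc (Suc n)) t - S (Suc n) t\<bar> \<le> A * (1 / 2) ^ Suc n * weight t" by simp
    qed
  qed
  have conv: "convergent (\<lambda>n. S n t)" if "t \<in> kappa J" for t
  proof -
    have "summable (\<lambda>n. S (Suc n) t - S n t)"
    proof (rule summable_comparison_test')
      show "summable (\<lambda>n. A * (1 / 2) ^ n * weight t)"
        by (intro summable_mult2 summable_mult summable_geometric) simp
      show "norm (S (Suc n) t - S n t) \<le> A * (1 / 2) ^ n * weight t" for n
        using S_step that by simp
    qed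
    then have "convergent (\<lambda>n. \<Sum>k<n. S (Suc k) t - S k t)"
      by (simp add: summable_iff_convergent)
    moreover have "(\<Sum>k<n. S (Suc k) t - S k t) = S n t" for n
      using sum_lessThan_telescope[of "\<lambda>n. S n t" n] by (simp add: S_0)
    ultimately show ?thesis by simp
  qed
  define g where "g t = lim (\<lambda>n. S n t)" for t
  have S_g: "(\<lambda>n. S n t) \<longlonglongrightarrow> g t" if "t \<in> kappa J" for t
    unfolding g_def using conv[OF that] by (simp add: convergent_LIMSEQ_iff)
  have left_end_kappa: "left_end y \<in> kappa J" if "a \<le> y" "y < b" for y
    using left_end_in_cell[OF order_refl a_in that] by (intro in_kappa) auto
  have S_bound': "\<bar>S n t\<bar> \<le> 2 * A * weight b" if "t \<in> kappa J" for n t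
  proof -
    have "2 * A * weight t \<le> 2 * A * weight b"
      using A0 that kappa_subset J_bounds(2) by (intro mult_left_mono weight_mono) auto
    then show ?thesis using S_bound[of n] that by force
  qed
  have g_bound: "\<bar>g t\<bar> \<le> 2 * A * weight b" if "t \<in> kappa J" for t
    by (rule tendsto_upperbound[OF tendsto_rabs[OF S_g[OF that]]]) (use S_bound'[OF that] in auto)
  have "(\<lambda>y. indicator {a..<b} y * g (left_end y)) \<in> borel_measurable borel"
    by (rule bounded_convergence_moving_end(1)[where u = "\<lambda>n y. S n (left_end y)" and x = "\<lambda>_. b"
          and b = b and C = "2 * A * weight b"])
      (use left_end_kappa S_bound' S_g cell_integrable_measurable[OF S_di] in auto)
  then have g_di: "cell_integrable b g"
    unfolding cell_integrable_def using g_bound in_kappa by (meson IntD1 IntD2 atLeastLessThan_iff)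
  have N_S: "(\<lambda>n. K1_op (S n) t) \<longlonglongrightarrow> K1_op g t" if t: "t \<in> J" for t
    unfolding K1_op_def delta_int_def
  proof (rule bounded_convergence_moving_end(2)[where b = b and C = "L * (2 * A * weight b)"])
    show "(\<lambda>y. indicator {a..<t} y * (K1 t (left_end y) * S n (left_end y))) \<in> borel_measurable borel" for n
      using cell_integrable_measurable[OF K1_op_cell_integrable[OF S_di t]] .
    show "t \<le> b" using J_bounds(2)[OF t] .
    then show "\<bar>K1 t (left_end y) * S n (left_end y)\<bar> \<le> L * (2 * A * weight b)" if "a \<le> y" "y < t" for n y
      unfolding abs_mult using left_end_in_cell[OF order_refl a_in that] t L_nonneg that
      by (intro mult_mono K1_bound S_bound' left_end_kappa) auto
    show "(\<lambda>n. K1 t (left_end y) * S n (left_end y)) \<longlonglongrightarrow> K1 t (left_end y) * g (left_end y)" if "a \<le> y" "y < t" for y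
      using J_bounds(2)[OF t] that by (intro tendsto_mult_left S_g left_end_kappa) auto
  qed simp
  have eq: "g t = F t + second_kind_op g t" if t: "t \<in> kappa J" for t
  proof (rule LIMSEQ_unique[OF LIMSEQ_Suc[OF S_g[OF t]]])
    have "t \<in> J" using t kappa_subset by auto
    then show "(\<lambda>n. S (Suc n) t) \<longlonglongrightarrow> F t + second_kind_op g t"
      unfolding S_Suc second_kind_op_def by (intro tendsto_intros N_S)
  qed
  moreover have "rd (kappa J) g"
  proof (rule rd_cong)
    show "rd (kappa J) (\<lambda>t. F t - (- 1) * second_kind_op g t)"
      by (intro rd_diff rd_mult rd_const F second_kind_op_rd g_di)
  qed (use eq in simp)
  ultimately show ?thesis by blast
qed

lemma first_kind_unique_solution:
  assumes f: "rd_C1 J f" "f a = 0"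
  shows "\<exists>\<phi>. volterra1_solution J a b K f \<phi> \<and>
    (\<forall>\<psi>. volterra1_solution J a b K f \<psi> \<longrightarrow> (\<forall>t\<in>kappa J. \<psi> t = \<phi> t))"
proof -
  obtain f' where f': "\<And>t. t \<in> kappa J \<Longrightarrow> has_delta_derivative J J f (f' t) t" "rd (kappa J) f'"
    using f(1) unfolding rd_C1_def by blast
  define F where "F t = inverse (diag t) * f' t" for t
  have F: "rd (kappa J) F" unfolding F_def[abs_def] by (rule rd_mult[OF inverse_diag_rd f'(2)])
  have "(\<forall>t\<in>kappa J. diag t * \<phi> t + K1_op \<phi> t = f' t) \<longleftrightarrow> (\<forall>t\<in>kappa J. \<phi> t = F t + second_kind_op \<phi> t)" for \<phi>
  proof (rule ball_cong[OF refl])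
    fix t assume "t \<in> kappa J"
    then show "diag t * \<phi> t + K1_op \<phi> t = f' t \<longleftrightarrow> \<phi> t = F t + second_kind_op \<phi> t"
      using diagonal_nonzero by (auto simp: F_def second_kind_op_def diag_def field_simps)
  qed
  then have sol: "volterra1_solution J a b K f \<phi> \<longleftrightarrow> rd (kappa J) \<phi> \<and> (\<forall>t\<in>kappa J. \<phi> t = F t + second_kind_op \<phi> t)" for \<phi>
    unfolding solution_iff using second_kind_iff[of \<phi> f f', OF _ f(2) f'(1)] by (simp cong: conj_cong)
  obtain \<phi> where \<phi>: "rd (kappa J) \<phi>" "\<And>t. t \<in> kappa J \<Longrightarrow> \<phi> t = F t + second_kind_op \<phi> t"
    using second_kind_exists[OF F] by blast
  show ?thesis
    using \<phi> second_kind_unique[of _ F \<phi>] unfolding sol by blast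
qed

end

theorem theorem6:
  fixes T J :: "real set" and a b :: real
    and K K1 :: "real \<Rightarrow> real \<Rightarrow> real" and f :: "real \<Rightarrow> real"
  assumes "time_scale T" and "a \<in> T" and "b \<in> T" and "b > a"
    and "J = T \<inter> {a..b}"
    and "delta1_derivative J a b K K1"
    and "rd_continuous_Omega J a b K"
    and "rd_continuous_Omega J a b K1"
    and "rd_C1 J f"
    and "\<forall>t \<in> kappa J. K (sigma J t) t \<noteq> 0"
    and "f a = 0"
    and "bounded ((\<lambda>(t, s). K1 t s) ` Omega J a b)"
    and "bounded ((\<lambda>t. 1 / K (sigma J t) t) ` kappa J)"
  shows "\<exists>\<phi>. volterra1_solution J a b K f \<phi> \<and>
           (\<forall>\<psi>. volterra1_solution J a b K f \<psi> \<longrightarrow> (\<forall>t \<in> kappa J. \<psi> t = \<phi> t))"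
proof -
  obtain L where L: "\<forall>x\<in>(\<lambda>(t, s). K1 t s) ` Omega J a b. norm x \<le> L"
    using assms(12) unfolding bounded_iff by blast
  obtain M where M: "\<forall>x\<in>(\<lambda>t. 1 / K (sigma J t) t) ` kappa J. norm x \<le> M"
    using assms(13) unfolding bounded_iff by blast
  interpret volterra_kernel J a b K K1 L M
  proof
    show "closed J" using assms(1,5) by (auto simp: time_scale_def)
    show "\<bar>K1 t s\<bar> \<le> L" if "s \<in> J" "t \<in> J" "s \<le> t" for t s
      using bspec[OF L, of "K1 t s"] that assms(5) by (force simp: Omega_def)
    show "\<bar>inverse (K (sigma J t) t)\<bar> \<le> M" if "t \<in> kappa J" for t
      using M that by (simp add: inverse_eq_divide)
  qed (use assms in auto)
  show ?thesis by (rule first_kind_unique_solution[OF assms(9,11)])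
qed

end
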